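(* Let $n$ range over a sequence of natural numbers going to infinity. For each $n$ in this sequence, let $f=f^{(n)}$ be a monic polynomial of degree $n$ with all zeroes in the closed unit disk $\{z\in\mathbb{C}:|z|\le1\}$, and let $a=a^{(n)}\in[0,1]$ be such that $f(a)=0$. Suppose that $a^{(n)}\to1$ as $n\to\infty$ along the sequence, and that there is a real number $\varepsilon_0>0$, not depending on $n$, such that $a^{(n)}\le 1-\varepsilon_0^n$ for all $n$ in the sequence. Then it is impossible that, for every $n$ in the sequence, $f'$ has no zeroes in the closed disk $\{z\in\mathbb{C}:|z-a|\le1\}$. *)

theory Defs
  imports Complex_Main "HOL-Computational_Algebra.Polynomial"
begin

end

theory Submission
  imports Defs "HOL-Analysis.Analysis" "HOL-Real_Asymp.Real_Asymp"
    "HOL-Computational_Algebra.Fundamental_Theorem_Algebra"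
begin

text \<open>
Fix one degree \<open>n\<close> for which \<open>f'\<close> has no zero in the closed disk of radius 1 around \<open>a\<close>, let
\<open>r i\<close> be the zeros of \<open>f\<close> and \<open>\<zeta> j\<close> the \<open>N = n - 1\<close> critical points. By Gauss--Lucas the
critical points lie in the unit disk, so they lie in the lens \<open>|\<zeta>| \<le> 1 \<le> |\<zeta> - a|\<close>, which for
\<open>a = 1\<close> touches the origin from the left. The proof shows that \<open>1 - a\<close> is then smaller than
\<open>c ^ n\<close> for every \<open>c > 0\<close> and large \<open>n\<close>, against \<open>1 - a \<ge> \<epsilon>\<^sub>0 ^ n\<close>. It has two stages.

Stage one: the critical points tend to the origin in mean square (\<open>sum_crit_squares_le\<close>). Since
\<open>f a = 0\<close> and \<open>|f'|\<close> decays exponentially to the left of \<open>a\<close>, a Laplace estimate gives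
\<open>|f (a - 1/4)| \<ge> |f' a| / (2 * N)\<close>. On the unit circle \<open>n * |f| \<le> 2 * |f'|\<close>, so at a point \<open>z\<close> of
the circle close to 1 the value \<open>|f' z|\<close> cannot be much smaller than \<open>|f' a|\<close>: otherwise \<open>f\<close> would
be too small all the way from \<open>z\<close> to \<open>a - 1/4\<close>. Apply this at \<open>z\<close> and at its conjugate. The
logarithm of \<open>|(z - \<zeta>) * (cnj z - \<zeta>)|\<close> minus that of \<open>|1 - \<zeta>|\<^sup>2\<close> is a second difference of
\<open>log |w - \<zeta>|\<close> along the circle; on the lens it is negative, by a multiple of \<open>|\<zeta>|\<^sup>2\<close>
(\<open>circle_pair_factor_le\<close>). So the sum of the \<open>|\<zeta> j|\<^sup>2\<close> is \<open>o(n)\<close>.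

Stage two: now \<open>f\<close> resembles \<open>z ^ n - a ^ n\<close>, and three facts become available. The low coefficients
of \<open>f\<close> are exponentially small, hence so are the sums of \<open>1 / r i\<close>, \<open>1 / r i ^ 2\<close> and
\<open>1 / r i ^ 3\<close>. A second Laplace estimate shows that \<open>|f 0|\<close>, the product of the \<open>|r i|\<close>, is
close to 1, with an error of the order of the mean of \<open>|\<zeta> j|\<^sup>2\<close> (\<open>norm_f_0_ge\<close>). As every
\<open>|r i| \<le> 1\<close>, the zeros are then close to their reflections \<open>1 / cnj (r i)\<close>, so the sums of
\<open>r i\<close>, \<open>r i ^ 2\<close> and \<open>r i ^ 3\<close> are small too, and by Newton's identities also those of
\<open>\<zeta> j\<close>, \<open>\<zeta> j ^ 2\<close> and \<open>\<zeta> j ^ 3\<close>. But \<open>Re (\<zeta> + \<zeta>\<^sup>2 + \<zeta> ^ 3 / 4) \<le> - |\<zeta>|\<^sup>2 / 4\<close> on the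
lens (\<open>lens_cubic_le\<close>), so the sum of the \<open>|\<zeta> j|\<^sup>2\<close> is bounded by a constant times its mean, which
is \<open>N\<close> times smaller, plus exponentially small terms. Hence it is itself exponentially small.
Finally \<open>1 - a \<le> |\<zeta>|\<^sup>2 - 2 * Re \<zeta>\<close> on the lens, and averaging makes \<open>1 - a\<close> exponentially small
(\<open>gap_le\<close>).
\<close>

section \<open>Products of nearly equal factors\<close>

text \<open>The inequality of the arithmetic and geometric means, from \<open>t \<le> exp (t - 1)\<close> applied to the ratio of
each factor to the mean.\<close>

lemma prod_le_mean_power:
  fixes x :: "nat \<Rightarrow> real"
  assumes "\<And>j. j < N \<Longrightarrow> 0 \<le> x j" and "N > 0"
  shows "(\<Prod>j<N. x j) \<le> ((\<Sum>j<N. x j) / N) ^ N"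
proof (cases "(\<Sum>j<N. x j) = 0")
  case True
  then have "x 0 = 0"
    using assms by (subst (asm) sum_nonneg_eq_0_iff) auto
  then have zero: "(\<Prod>j<N. x j) = 0"
    using assms(2) by (intro prod_zero bexI[of _ 0]) auto
  show ?thesis unfolding zero True by simp
next
  case False
  define m where "m = (\<Sum>j<N. x j) / N"
  have "(\<Sum>j<N. x j) \<ge> 0" using assms(1) by (intro sum_nonneg) auto
  then have m: "m > 0" using False assms(2) by (simp add: m_def)
  have "(\<Prod>j<N. x j) \<le> (\<Prod>j<N. m * exp (x j / m - 1))"
  proof (intro prod_mono conjI)
    fix j assume j: "j \<in> {..<N}"
    show "0 \<le> x j" using assms(1) j by simp
    have "x j / m \<le> exp (x j / m - 1)"
      using exp_ge_add_one_self[of "x j / m - 1"] by simp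
    then show "x j \<le> m * exp (x j / m - 1)"
      using m by (simp add: divide_le_eq mult.commute)
  qed
  also have "\<dots> = m ^ N * exp (\<Sum>j<N. (x j / m - 1))"
    by (simp add: prod.distrib exp_sum)
  also have "(\<Sum>j<N. (x j / m - 1)) = (\<Sum>j<N. x j) / m - N"
    by (simp add: sum_subtractf sum_divide_distrib)
  also have "\<dots> = 0"
    using False assms(2) by (simp add: m_def)
  finally show ?thesis by (simp add: m_def)
qed

lemma power_add_second_order:
  fixes \<alpha> \<beta> :: real
  assumes "\<alpha> \<ge> 0" "\<beta> \<ge> 0"
  shows "(\<alpha> + \<beta>) ^ (M + 2) \<le> \<alpha> ^ (M + 2) + (real M + 2) * \<alpha> ^ (M + 1) * \<beta>
           + (real M + 2) * (real M + 1) / 2 * \<beta>\<^sup>2 * (\<alpha> + \<beta>) ^ M"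
proof (induction M)
  case 0
  then show ?case by (simp add: power2_eq_square algebra_simps)
next
  case (Suc M)
  define S where "S = (\<alpha> + \<beta>) ^ M"
  define P where "P = \<alpha> ^ M"
  have SP: "\<alpha> * P \<le> (\<alpha> + \<beta>) * S"
    unfolding S_def P_def using assms by (metis add_increasing2 order_refl power_Suc power_mono)
  have "(\<alpha> + \<beta>) ^ (Suc M + 2) = (\<alpha> + \<beta>) * (\<alpha> + \<beta>) ^ (M + 2)" by simp
  also have "\<dots> \<le> (\<alpha> + \<beta>) * (\<alpha> ^ (M + 2) + (real M + 2) * \<alpha> ^ (M + 1) * \<beta>
           + (real M + 2) * (real M + 1) / 2 * \<beta>\<^sup>2 * (\<alpha> + \<beta>) ^ M)"
    by (rule mult_left_mono[OF Suc]) (use assms in auto)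
  also have "\<dots> = \<alpha> ^ (Suc M + 2) + (real (Suc M) + 2) * \<alpha> ^ (Suc M + 1) * \<beta>
      + (real M + 2) * (\<beta>\<^sup>2 * (\<alpha> * P)) + (real M + 2) * (real M + 1) / 2 * \<beta>\<^sup>2 * ((\<alpha> + \<beta>) * S)"
    unfolding S_def P_def by (simp add: algebra_simps power2_eq_square)
  also have "\<dots> \<le> \<alpha> ^ (Suc M + 2) + (real (Suc M) + 2) * \<alpha> ^ (Suc M + 1) * \<beta>
      + (real M + 2) * (\<beta>\<^sup>2 * ((\<alpha> + \<beta>) * S)) + (real M + 2) * (real M + 1) / 2 * \<beta>\<^sup>2 * ((\<alpha> + \<beta>) * S)"
    using SP by (intro add_mono mult_left_mono order_refl) auto
  also have "\<dots> = \<alpha> ^ (Suc M + 2) + (real (Suc M) + 2) * \<alpha> ^ (Suc M + 1) * \<beta>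
           + (real (Suc M) + 2) * (real (Suc M) + 1) / 2 * \<beta>\<^sup>2 * (\<alpha> + \<beta>) ^ Suc M"
    unfolding S_def by (simp add: field_simps)
  finally show ?case .
qed

text \<open>Expand both products in powers of the \<open>b j\<close>: each term of order at least two on the left is
dominated by the corresponding term on the right, and the terms of order zero and one have been removed.\<close>

lemma norm_prod_add_first_order:
  fixes A :: complex and b :: "nat \<Rightarrow> complex"
  shows "norm ((\<Prod>j<Suc N. A + b j) - A ^ Suc N - A ^ N * (\<Sum>j<Suc N. b j))
    \<le> (\<Prod>j<Suc N. norm A + norm (b j)) - norm A ^ Suc N - norm A ^ N * (\<Sum>j<Suc N. norm (b j))"
proof (induction N)
  case 0
  then show ?case by simp
next
  case (Suc N)
  define P S Q T where "P = (\<Prod>j<Suc N. A + b j)" and "S = (\<Sum>j<Suc N. b j)"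
    and "Q = (\<Prod>j<Suc N. norm A + norm (b j))" and "T = (\<Sum>j<Suc N. norm (b j))"
  define c where "c = b (Suc N)"
  have IH: "norm (P - A ^ Suc N - A ^ N * S) \<le> Q - norm A ^ Suc N - norm A ^ N * T"
    using Suc unfolding P_def S_def Q_def T_def .
  have ST: "norm S \<le> T" unfolding S_def T_def by (rule norm_sum)
  have "(A + c) * P - A ^ Suc (Suc N) - A ^ Suc N * (S + c)
      = (A + c) * (P - A ^ Suc N - A ^ N * S) + c * A ^ N * S"
    by (simp add: algebra_simps)
  also have "norm \<dots> \<le> norm (A + c) * norm (P - A ^ Suc N - A ^ N * S) + norm c * norm A ^ N * norm S"
    by (metis norm_mult norm_power norm_triangle_ineq)
  also have "\<dots> \<le> (norm A + norm c) * (Q - norm A ^ Suc N - norm A ^ N * T) + norm c * norm A ^ N * T"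
    by (intro add_mono mult_mono IH ST norm_triangle_ineq) auto
  also have "\<dots> = (norm A + norm c) * Q - norm A ^ Suc (Suc N) - norm A ^ Suc N * (T + norm c)"
    by (simp add: algebra_simps)
  finally show ?case
    by (simp add: P_def S_def Q_def T_def c_def mult.commute)
qed

text \<open>Factors whose deviations from \<open>A\<close> sum to zero: the first-order term vanishes, so the error is
quadratic in the mean deviation \<open>\<beta>\<close>. By the inequality of the means the majorant depends on the
\<open>b j\<close> only through \<open>\<beta>\<close>, so that \<open>A\<close> may be small compared with some of the \<open>b j\<close>.\<close>

lemma norm_prod_minus_mean_power:
  fixes A :: complex and b :: "nat \<Rightarrow> complex"
  assumes "(\<Sum>j<N. b j) = 0" and N: "N \<ge> 2"
  defines "\<beta> \<equiv> (\<Sum>j<N. norm (b j)) / N"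
  shows "norm ((\<Prod>j<N. A + b j) - A ^ N) \<le> real N ^ 2 / 2 * \<beta>\<^sup>2 * (norm A + \<beta>) ^ (N - 2)"
proof -
  obtain M where M: "N = M + 2" using N by (metis add.commute le_Suc_ex)
  have \<beta>: "\<beta> \<ge> 0" unfolding \<beta>_def by (intro divide_nonneg_nonneg sum_nonneg) auto
  have sb: "(\<Sum>j<N. norm (b j)) = N * \<beta>" using N by (simp add: \<beta>_def)
  have "norm ((\<Prod>j<N. A + b j) - A ^ N) \<le>
    (\<Prod>j<N. norm A + norm (b j)) - norm A ^ N - norm A ^ (M + 1) * (N * \<beta>)"
    using norm_prod_add_first_order[of A b "M + 1"] assms(1) sb M by simp
  also have "(\<Prod>j<N. norm A + norm (b j)) \<le> ((\<Sum>j<N. norm A + norm (b j)) / N) ^ N"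
    using N by (intro prod_le_mean_power) auto
  also have "(\<Sum>j<N. norm A + norm (b j)) / N = norm A + \<beta>"
    using N by (simp add: sum.distrib sb field_simps)
  also have "(norm A + \<beta>) ^ N - norm A ^ N - norm A ^ (M + 1) * (N * \<beta>)
      \<le> real N * (real N - 1) / 2 * \<beta>\<^sup>2 * (norm A + \<beta>) ^ M"
    using power_add_second_order[of "norm A" \<beta> M] \<beta> unfolding M by (simp add: field_simps)
  also have "\<dots> \<le> real N ^ 2 / 2 * \<beta>\<^sup>2 * (norm A + \<beta>) ^ M"
    using \<beta> by (intro mult_right_mono) (auto simp: power2_eq_square field_simps)
  finally show ?thesis by (simp add: M)
qed

lemma norm_prod_diff_scaled:
  fixes z w :: "nat \<Rightarrow> complex"
  assumes "\<And>j. j < N \<Longrightarrow> norm (z j) \<le> q" "\<And>j. j < N \<Longrightarrow> norm (w j) \<le> q" "q > 0"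
  shows "norm ((\<Prod>j<N. z j) - (\<Prod>j<N. w j)) \<le> q ^ N / q * (\<Sum>j<N. norm (z j - w j))"
proof -
  have "norm ((\<Prod>j<N. z j / q) - (\<Prod>j<N. w j / q)) \<le> (\<Sum>j<N. norm (z j / q - w j / q))"
    using assms by (intro norm_prod_diff) (auto simp: norm_divide)
  also have "(\<Sum>j<N. norm (z j / q - w j / q)) = (\<Sum>j<N. norm (z j - w j)) / q"
    using assms(3) by (simp add: sum_divide_distrib norm_divide flip: diff_divide_distrib)
  also have "(\<Prod>j<N. z j / q) - (\<Prod>j<N. w j / q) = ((\<Prod>j<N. z j) - (\<Prod>j<N. w j)) / q ^ N"
    by (simp add: prod_dividef diff_divide_distrib)
  finally show ?thesis
    using assms(3) by (simp add: norm_divide norm_power field_simps)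
qed

lemma norm_exp_minus_linear_le:
  fixes z :: complex
  assumes "norm z \<le> 1/4"
  shows "norm (exp z - (1 + z)) \<le> 2 * norm z ^ 2"
proof -
  have *: "norm (exp z - (\<Sum>k\<le>1. z ^ k / fact k)) \<le> exp \<bar>Re z\<bar> * norm z ^ Suc 1 / fact 1"
    by (rule Taylor_exp)
  have "exp \<bar>Re z\<bar> \<le> exp (1/2::real)"
    unfolding exp_le_cancel_iff using abs_Re_le_cmod[of z] assms by linarith
  moreover have "exp (1/2::real) \<le> 2"
    using exp_bound_half[of "1/2::real"] by simp
  ultimately have "exp \<bar>Re z\<bar> \<le> 2" by (rule order_trans)
  then have "exp \<bar>Re z\<bar> * norm z ^ 2 \<le> 2 * norm z ^ 2"
    by (intro mult_right_mono) auto
  with * show ?thesis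
    by (simp add: numeral_2_eq_2)
qed

text \<open>The common last step of the two Laplace estimates: the majorant \<open>K * t\<^sup>2 * exp (- M * t)\<close> has total
integral \<open>2 * K / M ^ 3\<close>, and comparing with an explicit antiderivative of it avoids integrals.\<close>

lemma quadratic_exp_derivative_bound:
  fixes h :: "real \<Rightarrow> complex" and K M T :: real
  assumes "T > 0" "M > 0" "K \<ge> 0"
    and h: "\<And>t. (h has_vector_derivative h' t) (at t)"
    and h': "\<And>t. 0 < t \<Longrightarrow> t < T \<Longrightarrow> norm (h' t) \<le> K * t\<^sup>2 * exp (- M * t)"
  shows "norm (h T - h 0) \<le> 2 * K / M ^ 3"
proof -
  \<comment> \<open>the antiderivative of the majorant that tends to 0 at infinity\<close>
  define \<phi> where "\<phi> t = - K * exp (- M * t) * (t\<^sup>2 / M + 2 * t / M\<^sup>2 + 2 / M ^ 3)" for t :: real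
  have \<phi>': "(\<phi> has_real_derivative K * t\<^sup>2 * exp (- M * t)) (at t)" for t
    unfolding \<phi>_def using assms(2)
    by (auto intro!: derivative_eq_intros simp: field_simps power2_eq_square power3_eq_cube)
  have "norm (h T - h 0) \<le> \<phi> T - \<phi> 0"
  proof (rule differentiable_bound_general[OF assms(1)])
    show "continuous_on {0..T} h"
      using h by (meson continuous_at_imp_continuous_on has_vector_derivative_continuous)
    show "continuous_on {0..T} \<phi>"
      using \<phi>' by (meson continuous_at_imp_continuous_on DERIV_isCont)
    show "(\<phi> has_vector_derivative K * t\<^sup>2 * exp (- M * t)) (at t)" for t
      using \<phi>' by (simp add: has_real_derivative_iff_has_vector_derivative)
  qed (use h h' in auto)
  also have "\<dots> \<le> - \<phi> 0"
    using assms by (simp add: \<phi>_def)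
  also have "\<dots> = 2 * K / M ^ 3"
    by (simp add: \<phi>_def)
  finally show ?thesis .
qed

text \<open>A product of factors \<open>\<rho> \<le> exp (\<rho> - 1)\<close> is at most \<open>exp\<close> of minus the total defect.\<close>

lemma prod_near_one:
  fixes \<rho> :: "nat \<Rightarrow> real"
  assumes "\<And>i. i < n \<Longrightarrow> 0 \<le> \<rho> i" "0 \<le> x" "x \<le> 1 / 2" "1 - x \<le> (\<Prod>i<n. \<rho> i)"
  shows "(\<Sum>i<n. 1 - \<rho> i) \<le> 2 * x"
proof -
  have "1 \<le> (1 - x) * (1 + 2 * x)"
    using mult_left_mono[of "2 * x" 1 x] assms by (simp add: algebra_simps)
  also have "\<dots> \<le> (1 - x) * exp (2 * x)"
    using assms by (intro mult_left_mono exp_ge_add_one_self) auto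
  finally have "exp (- (2 * x)) \<le> 1 - x" by (simp add: exp_minus field_simps)
  also have "\<dots> \<le> (\<Prod>i<n. \<rho> i)" by fact
  also have "\<dots> \<le> (\<Prod>i<n. exp (- (1 - \<rho> i)))"
  proof (intro prod_mono conjI)
    fix i assume "i \<in> {..<n}"
    then show "0 \<le> \<rho> i" using assms(1) by simp
    show "\<rho> i \<le> exp (- (1 - \<rho> i))" using exp_ge_add_one_self[of "- (1 - \<rho> i)"] by simp
  qed
  also have "\<dots> = exp (- (\<Sum>i<n. 1 - \<rho> i))" by (simp only: exp_sum finite_lessThan sum_negf[symmetric])
  finally show ?thesis by (simp only: exp_le_cancel_iff neg_le_iff_le)
qed

section \<open>Polynomials through their zeros\<close>

lemma coeff_linear_factors_0:
  "coeff (\<Prod>i<N. [:1, - x i:]) 0 = (1::complex)" for N :: nat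
  by (induction N) (auto simp: mult.commute)

text \<open>The first three Newton identities, by adding one factor at a time.\<close>

lemma power_sums_eq_coeffs:
  fixes x :: "nat \<Rightarrow> complex" and N :: nat
  defines "P \<equiv> \<Prod>i<N. [:1, - x i:]"
  shows "(\<Sum>i<N. x i) = - coeff P 1"
    and "(\<Sum>i<N. x i ^ 2) = coeff P 1 ^ 2 - 2 * coeff P 2"
    and "(\<Sum>i<N. x i ^ 3) = - (coeff P 1 ^ 3) + 3 * coeff P 1 * coeff P 2 - 3 * coeff P 3"
proof -
  define Q where "Q N = (\<Prod>i<N. [:1, - x i:])" for N
  have S: "Q (Suc N) = [:1, - x N:] * Q N" for N by (simp add: Q_def mult.commute)
  have c0: "coeff (Q N) 0 = 1" for N by (simp add: Q_def coeff_linear_factors_0)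
  have c: "coeff (Q (Suc N)) (Suc k) = coeff (Q N) (Suc k) - x N * coeff (Q N) k" for N k
    by (simp add: S)
  have Q0: "Q 0 = 1" by (simp add: Q_def)
  have c1: "coeff (Q (Suc N)) 1 = coeff (Q N) 1 - x N" for N
    using c[of N 0] c0 by simp
  have c2: "coeff (Q (Suc N)) 2 = coeff (Q N) 2 - x N * coeff (Q N) 1" for N
    using c[of N 1] by (simp add: numeral_2_eq_2)
  have c3: "coeff (Q (Suc N)) 3 = coeff (Q N) 3 - x N * coeff (Q N) 2" for N
    using c[of N 2] by (simp add: numeral_3_eq_3 numeral_2_eq_2)
  have "(\<Sum>i<N. x i) = - coeff (Q N) 1 \<and> (\<Sum>i<N. x i ^ 2) = coeff (Q N) 1 ^ 2 - 2 * coeff (Q N) 2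
    \<and> (\<Sum>i<N. x i ^ 3) = - (coeff (Q N) 1 ^ 3) + 3 * coeff (Q N) 1 * coeff (Q N) 2 - 3 * coeff (Q N) 3"
  proof (induction N)
    case 0
    then show ?case by (simp add: Q0)
  next
    case (Suc N)
    then show ?case
      by (simp only: sum.lessThan_Suc c1 c2 c3) (simp add: algebra_simps power2_eq_square power3_eq_cube)
  qed
  then show "(\<Sum>i<N. x i) = - coeff P 1"
    and "(\<Sum>i<N. x i ^ 2) = coeff P 1 ^ 2 - 2 * coeff P 2"
    and "(\<Sum>i<N. x i ^ 3) = - (coeff P 1 ^ 3) + 3 * coeff P 1 * coeff P 2 - 3 * coeff P 3"
    by (auto simp: P_def Q_def)
qed

lemma power_sums_small:
  fixes x :: "nat \<Rightarrow> complex"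
  assumes c: "\<And>k. k \<in> {1, 2, 3} \<Longrightarrow> norm (coeff (\<Prod>i<N. [:1, - x i:]) k) \<le> D" and D: "D \<le> 1"
    and k: "k \<in> {1, 2, 3}"
  shows "norm (\<Sum>i<N. x i ^ k) \<le> 7 * D"
proof -
  define e where "e k = coeff (\<Prod>i<N. [:1, - x i:]) k" for k
  have e: "norm (e 1) \<le> D" "norm (e 2) \<le> D" "norm (e 3) \<le> D" using c[of 1] c[of 2] c[of 3] by (auto simp: e_def)
  have D0: "0 \<le> D" using e(1) norm_ge_zero[of "e 1"] by linarith
  have e11: "norm (e 1) * norm (e 1) \<le> D * 1"
    using e D D0 by (intro mult_mono) auto
  have e12: "norm (e 1) * norm (e 2) \<le> D * 1"
    using e D D0 by (intro mult_mono) auto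
  have e111: "norm (e 1) * (norm (e 1) * norm (e 1)) \<le> 1 * (D * 1)"
    using e D D0 e11 by (intro mult_mono) auto
  have 1: "norm (\<Sum>i<N. x i) \<le> D"
    using e power_sums_eq_coeffs(1)[of x N] by (simp add: e_def)
  have "norm (\<Sum>i<N. x i ^ 2) \<le> norm (e 1 ^ 2) + norm (2 * e 2)"
    unfolding power_sums_eq_coeffs(2) e_def by (rule norm_triangle_ineq4)
  then have 2: "norm (\<Sum>i<N. x i ^ 2) \<le> 3 * D"
    using e e11 by (simp add: norm_mult norm_power power2_eq_square)
  have "norm (\<Sum>i<N. x i ^ 3) \<le> norm (- (e 1 ^ 3) + 3 * e 1 * e 2) + norm (3 * e 3)"
    unfolding power_sums_eq_coeffs(3) e_def by (rule norm_triangle_ineq4)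
  also have "norm (- (e 1 ^ 3) + 3 * e 1 * e 2) \<le> norm (- (e 1 ^ 3)) + norm (3 * e 1 * e 2)"
    by (rule norm_triangle_ineq)
  finally have 3: "norm (\<Sum>i<N. x i ^ 3) \<le> 7 * D"
    using e e12 e111 by (simp add: norm_mult norm_power power3_eq_cube)
  from 1 2 3 D0 k show ?thesis by auto
qed

lemma coeffs_small:
  fixes x :: "nat \<Rightarrow> complex"
  assumes p: "\<And>k. k \<in> {1, 2, 3} \<Longrightarrow> norm (\<Sum>i<N. x i ^ k) \<le> y" and y: "y \<le> 1"
    and k: "k \<in> {1, 2, 3}"
  shows "norm (coeff (\<Prod>i<N. [:1, - x i:]) k) \<le> 2 * y"
proof -
  define e where "e k = coeff (\<Prod>i<N. [:1, - x i:]) k" for k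
  define s where "s k = (\<Sum>i<N. x i ^ k)" for k
  have s: "norm (s 1) \<le> y" "norm (s 2) \<le> y" "norm (s 3) \<le> y" using p[of 1] p[of 2] p[of 3] by (auto simp: s_def)
  have y0: "0 \<le> y" using s(1) norm_ge_zero[of "s 1"] by linarith
  have e1: "e 1 = - s 1"
    using power_sums_eq_coeffs(1)[of x N] by (simp add: e_def s_def)
  have e2: "2 * e 2 = e 1 * e 1 - s 2"
    using power_sums_eq_coeffs(2)[of x N] by (simp add: e_def s_def power2_eq_square)
  have e3: "3 * e 3 = - (e 1 * (e 1 * e 1)) + 3 * (e 1 * e 2) - s 3"
    using power_sums_eq_coeffs(3)[of x N] by (simp add: e_def s_def power3_eq_cube)
  have n1: "norm (e 1) \<le> y" using s e1 by simp
  have e11: "norm (e 1) * norm (e 1) \<le> y * 1"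
    using n1 y y0 by (intro mult_mono) auto
  have "norm (2 * e 2) \<le> norm (e 1 * e 1) + norm (s 2)"
    unfolding e2 by (rule norm_triangle_ineq4)
  then have n2: "norm (e 2) \<le> y" using s e11 by (simp add: norm_mult)
  have e12: "norm (e 1) * norm (e 2) \<le> y * 1"
    using n1 n2 y y0 by (intro mult_mono) auto
  have e111: "norm (e 1) * (norm (e 1) * norm (e 1)) \<le> 1 * (y * 1)"
    using n1 y y0 e11 by (intro mult_mono) auto
  have "norm (3 * e 3) \<le> norm (- (e 1 * (e 1 * e 1)) + 3 * (e 1 * e 2)) + norm (s 3)"
    unfolding e3 by (rule norm_triangle_ineq4)
  also have "norm (- (e 1 * (e 1 * e 1)) + 3 * (e 1 * e 2))
      \<le> norm (- (e 1 * (e 1 * e 1))) + norm (3 * (e 1 * e 2))"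
    by (rule norm_triangle_ineq)
  finally have "norm (e 3) \<le> 2 * y"
    using s e12 e111 y0 by (simp add: norm_mult)
  then show ?thesis using n1 n2 y0 k by (auto simp: e_def)
qed

lemma degree_prod_monic_linear:
  fixes x :: "nat \<Rightarrow> complex"
  shows "degree (\<Prod>i<N. [:- x i, 1:]) = N"
  by (simp add: degree_prod_eq_sum_degree)

lemma coeff_reversed_linear_factors:
  fixes x :: "nat \<Rightarrow> complex"
  assumes "k \<le> N"
  shows "coeff (\<Prod>i<N. [:1, - x i:]) k = coeff (\<Prod>i<N. [:- x i, 1:]) (N - k)"
proof -
  have r: "reflect_poly [:- y, 1:] = [:1, - y:]" for y :: complex
    by (simp add: reflect_poly_pCons' monom_Suc monom_0)
  have "(\<Prod>i<N. [:1, - x i:]) = reflect_poly (\<Prod>i<N. [:- x i, 1:])"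
    by (simp add: reflect_poly_prod r)
  then show ?thesis
    using assms degree_prod_monic_linear[of x N] by (simp add: coeff_reflect_poly)
qed

text \<open>The coefficients of a product of linear factors are dominated by those of the product with \<open>- x i\<close>
replaced by \<open>norm (x i)\<close>, and a polynomial with nonnegative coefficients dominates each of its terms at \<open>\<kappa>\<close>.\<close>

lemma norm_coeff_linear_factors_le:
  fixes x :: "nat \<Rightarrow> complex" and \<kappa> :: real
  assumes "\<kappa> > 0"
  shows "norm (coeff (\<Prod>i<N. [:- x i, 1:]) k) * \<kappa> ^ k \<le> (\<Prod>i<N. \<kappa> + norm (x i))"
proof (induction N arbitrary: k)
  case 0
  then show ?case by (cases k) auto
next
  case (Suc N)
  define P where "P = (\<Prod>i<N. [:- x i, 1:])"
  define R where "R = (\<Prod>i<N. \<kappa> + norm (x i))"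
  have IH: "norm (coeff P k) * \<kappa> ^ k \<le> R" for k using Suc unfolding P_def R_def .
  have R: "R \<ge> 0" unfolding R_def using assms by (intro prod_nonneg) auto
  have E: "(\<Prod>i<Suc N. [:- x i, 1:]) = [:- x N, 1:] * P" by (simp add: P_def mult.commute)
  show ?case
  proof (cases k)
    case 0
    have "norm (coeff ([:- x N, 1:] * P) k) * \<kappa> ^ k = norm (x N) * (norm (coeff P 0) * \<kappa> ^ 0)"
      by (simp add: 0 norm_mult)
    also have "\<dots> \<le> norm (x N) * R" by (intro mult_left_mono IH) auto
    also have "\<dots> \<le> (\<kappa> + norm (x N)) * R" using assms R by (intro mult_right_mono) auto
    finally show ?thesis by (simp only: P_def R_def prod.lessThan_Suc mult.commute)
  next
    case (Suc l)
    have "norm (coeff ([:- x N, 1:] * P) k) = norm (coeff P l - x N * coeff P k)"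
      by (simp add: Suc)
    also have "\<dots> \<le> norm (coeff P l) + norm (x N) * norm (coeff P k)"
      using norm_triangle_ineq4[of "coeff P l" "x N * coeff P k"] by (simp add: norm_mult)
    finally have "norm (coeff ([:- x N, 1:] * P) k) * \<kappa> ^ k
        \<le> (norm (coeff P l) + norm (x N) * norm (coeff P k)) * \<kappa> ^ k"
      using assms by (intro mult_right_mono) auto
    also have "\<dots> = \<kappa> * (norm (coeff P l) * \<kappa> ^ l) + norm (x N) * (norm (coeff P k) * \<kappa> ^ k)"
      by (simp add: Suc algebra_simps)
    also have "\<dots> \<le> \<kappa> * R + norm (x N) * R"
      using assms by (intro add_mono mult_left_mono IH) auto
    finally have "norm (coeff ([:- x N, 1:] * P) k) * \<kappa> ^ k \<le> (\<kappa> + norm (x N)) * R"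
      by (simp only: distrib_right)
    then show ?thesis by (simp only: P_def R_def prod.lessThan_Suc mult.commute)
  qed
qed

text \<open>The condition \<open>Re (z / d) \<ge> 1 / 2\<close> says that \<open>z\<close> is at least as far from 0 as from \<open>d\<close>; here
\<open>d = z - w\<close>.\<close>

lemma Re_frac_ge_half:
  fixes z w :: complex
  assumes "norm w \<le> norm z" "z \<noteq> w"
  shows "Re (z / (z - w)) \<ge> 1 / 2"
proof -
  define d where "d = z - w"
  have w: "w = z - d" by (simp add: d_def)
  have "norm w ^ 2 \<le> norm z ^ 2" using assms by (intro power_mono) auto
  then have "(Re d)\<^sup>2 + (Im d)\<^sup>2 \<le> 2 * (Re z * Re d + Im z * Im d)"
    unfolding cmod_power2 w by (simp add: power2_eq_square algebra_simps)
  moreover have "(Re d)\<^sup>2 + (Im d)\<^sup>2 > 0"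
    using assms(2) unfolding d_def by (metis complex_neq_0 eq_iff_diff_eq_0)
  ultimately show ?thesis
    by (simp add: Re_divide field_simps flip: d_def)
qed

lemma pderiv_monic_linear_factors:
  fixes x :: "nat \<Rightarrow> complex"
  assumes "\<And>i. i < n \<Longrightarrow> z \<noteq> x i"
  shows "poly (pderiv (\<Prod>i<n. [:- x i, 1:])) z = poly (\<Prod>i<n. [:- x i, 1:]) z * (\<Sum>i<n. 1 / (z - x i))"
  using assms
proof (induction n)
  case 0
  then show ?case by simp
next
  case (Suc n)
  define P where "P = (\<Prod>i<n. [:- x i, 1:])"
  have IH: "poly (pderiv P) z = poly P z * (\<Sum>i<n. 1 / (z - x i))"
    using Suc unfolding P_def by simp
  have "z - x n \<noteq> 0" using Suc.prems by simp
  then have "poly P z + (z - x n) * poly (pderiv P) z = poly P z * (z - x n) * (\<Sum>i<Suc n. 1 / (z - x i))"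
    by (simp add: IH field_simps)
  moreover have "pderiv (P * [:- x n, 1:]) = P + [:- x n, 1:] * pderiv P"
    by (simp only: pderiv_mult pderiv_pCons) simp
  ultimately have "poly (pderiv (P * [:- x n, 1:])) z = poly (P * [:- x n, 1:]) z * (\<Sum>i<Suc n. 1 / (z - x i))"
    by (simp only: poly_add poly_mult) (simp add: algebra_simps)
  then show ?case by (simp add: P_def)
qed

text \<open>Each of the \<open>n\<close> terms of \<open>z * f' z / f z\<close> has real part at least \<open>1 / 2\<close>. This contains the
Gauss--Lucas theorem for the unit disk: \<open>f\<close> has no zero outside, hence neither has \<open>f'\<close>.\<close>

lemma poly_le_pderiv_outside_disk:
  fixes x :: "nat \<Rightarrow> complex"
  assumes "\<And>i. i < n \<Longrightarrow> norm (x i) \<le> 1" "norm z \<ge> 1"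
  defines "f \<equiv> \<Prod>i<n. [:- x i, 1:]"
  shows "n * norm (poly f z) \<le> 2 * norm z * norm (poly (pderiv f) z)"
proof (cases "\<exists>i<n. z = x i")
  case True
  then have "poly f z = 0" by (auto simp: f_def poly_prod)
  then show ?thesis by simp
next
  case False
  have "real n / 2 = (\<Sum>i<n. 1 / 2)" by simp
  also have "\<dots> \<le> (\<Sum>i<n. Re (z / (z - x i)))"
  proof (intro sum_mono Re_frac_ge_half)
    fix i assume "i \<in> {..<n}"
    then show "norm (x i) \<le> norm z" "z \<noteq> x i"
      using assms(1)[of i] assms(2) False by auto
  qed
  also have "\<dots> = Re (z * (\<Sum>i<n. 1 / (z - x i)))"
    by (simp add: sum_distrib_left)
  also have "\<dots> \<le> norm (z * (\<Sum>i<n. 1 / (z - x i)))"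
    by (rule complex_Re_le_cmod)
  finally have "n * norm (poly f z) \<le> 2 * norm (z * (\<Sum>i<n. 1 / (z - x i))) * norm (poly f z)"
    by (intro mult_right_mono) auto
  also have "poly (pderiv f) z = poly f z * (\<Sum>i<n. 1 / (z - x i))"
    using False unfolding f_def by (intro pderiv_monic_linear_factors) auto
  then have "2 * norm (z * (\<Sum>i<n. 1 / (z - x i))) * norm (poly f z) = 2 * norm z * norm (poly (pderiv f) z)"
    by (simp add: norm_mult)
  finally show ?thesis .
qed

section \<open>The lens containing the critical points\<close>

text \<open>With \<open>\<epsilon> = norm (z - 1) ^ 2\<close> and \<open>U = 1 / (1 - w)\<close> the product on the left is
\<open>(1 - w) ^ 2 * (1 + \<epsilon> * (U\<^sup>2 - U))\<close>. The assumptions on \<open>w\<close> say that \<open>Re U \<ge> 1 / 2\<close> and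
\<open>norm U \<le> 1\<close>, and there \<open>Re (U\<^sup>2 - U) \<le> - norm (U - 1) ^ 2\<close>. So moving from 1 to both
points \<open>z\<close> and \<open>cnj z\<close> of the circle loses a definite amount unless \<open>w = 0\<close>.\<close>

lemma circle_pair_factor_le:
  fixes w z :: complex
  assumes w: "norm w \<le> 1" "1 \<le> norm (1 - w)" and z: "norm z = 1" "norm (z - 1) \<le> 1"
  shows "norm ((z - w) * (cnj z - w)) \<le>
    norm (1 - w) ^ 2 * exp (- (norm (z - 1) ^ 2 / 2 * (norm w / norm (1 - w)) ^ 2))"
proof -
  define \<epsilon> where "\<epsilon> = norm (z - 1) ^ 2"
  define U where "U = 1 / (1 - w)"
  define X Y where "X = Re U" and "Y = Im U"
  define q where "q = (norm w / norm (1 - w)) ^ 2"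
  have w1: "1 - w \<noteq> 0" using w by auto
  have zz: "(Re z)\<^sup>2 + (Im z)\<^sup>2 = 1" using z(1) by (metis cmod_power2 one_power2)
  have \<epsilon>: "0 \<le> \<epsilon>" "\<epsilon> \<le> 1" using z by (auto simp: \<epsilon>_def power_le_one)
  have "\<epsilon> = (Re z)\<^sup>2 + (Im z)\<^sup>2 - 2 * Re z + 1"
    unfolding \<epsilon>_def cmod_power2 by (simp add: power2_eq_square algebra_simps)
  then have \<epsilon>z: "\<epsilon> = 2 - 2 * Re z" using zz by simp
  have "z * cnj z = 1" using z(1) by (simp add: complex_norm_square[symmetric])
  moreover have "z + cnj z = 2 - complex_of_real \<epsilon>" by (simp add: complex_add_cnj \<epsilon>z)
  moreover have "(z - w) * (cnj z - w) = z * cnj z - (z + cnj z) * w + w ^ 2"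
    by (simp add: power2_eq_square algebra_simps)
  ultimately have "(z - w) * (cnj z - w) = 1 - (2 - of_real \<epsilon>) * w + w ^ 2"
    by simp
  also have "\<dots> = (1 - w) ^ 2 + \<epsilon> * w"
    by (simp add: power2_eq_square algebra_simps)
  also have "\<dots> = (1 - w) ^ 2 + \<epsilon> * ((1 - w) * U * ((1 - w) * U - (1 - w)))"
    using w1 by (simp add: U_def)
  also have "\<dots> = (1 - w) ^ 2 * (1 + \<epsilon> * (U * (U - 1)))"
    by (simp add: power2_eq_square algebra_simps)
  finally have fac: "norm ((z - w) * (cnj z - w)) = norm (1 - w) ^ 2 * norm (1 + \<epsilon> * (U * (U - 1)))"
    by (simp add: norm_mult norm_power)
  have "norm U \<le> 1" using w by (simp add: U_def norm_divide divide_simps)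
  then have "norm U ^ 2 \<le> 1" by (simp add: power_le_one)
  then have XY: "X\<^sup>2 + Y\<^sup>2 \<le> 1" by (simp add: cmod_power2 X_def Y_def)
  have X: "X \<ge> 1 / 2" unfolding X_def U_def using Re_frac_ge_half[of w 1] w w1 by auto
  have "X\<^sup>2 \<le> 1" using XY by (smt (verit) zero_le_power2)
  then have X1: "X \<le> 1" by (simp add: abs_square_le_1)
  have "U - 1 = w / (1 - w)" using w1 by (simp add: U_def field_simps)
  then have "q = norm (U - 1) ^ 2" by (simp add: q_def norm_divide)
  then have q: "q = (X - 1)\<^sup>2 + Y\<^sup>2" by (simp add: cmod_power2 X_def Y_def)
  have "norm (1 + \<epsilon> * (U * (U - 1))) ^ 2
      = 1 + 2 * \<epsilon> * (X\<^sup>2 - Y\<^sup>2 - X) + \<epsilon>\<^sup>2 * ((X\<^sup>2 + Y\<^sup>2) * q)"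
    unfolding cmod_power2 q X_def Y_def by (simp add: power2_eq_square algebra_simps)
  also have "\<dots> \<le> 1 + 2 * \<epsilon> * (- q) + \<epsilon> * q"
  proof (intro add_mono mult_left_mono order_refl)
    have "0 \<le> (1 - X) * (2 * X - 1)" using X X1 by simp
    then show "X\<^sup>2 - Y\<^sup>2 - X \<le> - q"
      by (simp add: q power2_eq_square algebra_simps)
    have "\<epsilon>\<^sup>2 \<le> \<epsilon>" using \<epsilon> by (simp add: power2_eq_square mult_left_le)
    moreover have "(X\<^sup>2 + Y\<^sup>2) * q \<le> q" using XY by (simp add: mult_left_le_one_le q)
    ultimately show "\<epsilon>\<^sup>2 * ((X\<^sup>2 + Y\<^sup>2) * q) \<le> \<epsilon> * q"
      using \<epsilon> by (intro mult_mono) (auto simp: q)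
  qed (use \<epsilon> in auto)
  also have "\<dots> = 1 + - (\<epsilon> * q)" by simp
  also have "\<dots> \<le> exp (- (\<epsilon> * q))" by (rule exp_ge_add_one_self)
  also have "\<dots> = exp (- (\<epsilon> / 2 * q)) ^ 2" by (simp flip: exp_of_nat_mult)
  finally have "norm (1 + \<epsilon> * (U * (U - 1))) \<le> exp (- (\<epsilon> / 2 * q))"
    by (rule power2_le_imp_le) auto
  then show ?thesis unfolding fac \<epsilon>_def[symmetric] q_def[symmetric]
    by (intro mult_left_mono) auto
qed

text \<open>The test function that detects the size of \<open>z\<close> from its power sums. Near 0 the lens forces
\<open>Re z \<le> norm z ^ 2 / 2\<close>; in the extreme case of equality \<open>z\<close> is nearly imaginary and \<open>Re (z ^ 2)\<close>
outweighs \<open>Re z\<close>. The function \<open>Re (z + z\<^sup>2)\<close> alone also vanishes at the three cube roots of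
\<open>-1\<close>, which belong to the lens; \<open>Re (z ^ 3) = - 1\<close> at these points, so a positive multiple of
\<open>Re (z ^ 3)\<close> repairs this. With the multiple \<open>1 / 4\<close> the difference of the two sides factors as
\<open>(1 + x) * (x * (1 + x) - 3 / 4 * s)\<close>, where \<open>x = Re z\<close> and \<open>s = norm z ^ 2\<close>.\<close>

lemma lens_cubic_le:
  fixes z :: complex
  assumes "norm z \<le> 1" "2 * Re z \<le> norm z ^ 2"
  shows "Re z + Re (z ^ 2) + Re (z ^ 3) / 4 \<le> - (norm z ^ 2 / 4)"
proof -
  define x s where "x = Re z" and "s = norm z ^ 2"
  have s: "s = x\<^sup>2 + (Im z)\<^sup>2" by (simp add: s_def x_def cmod_power2)
  have s1: "s \<le> 1" using assms(1) by (simp add: s_def power_le_one)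
  have x1: "- 1 \<le> x" using abs_Re_le_cmod[of z] assms(1) by (simp add: x_def)
  have "x * (1 + x) \<le> 3 / 4 * s"
  proof (cases "x \<ge> 0")
    case True
    have "x \<le> 1 / 2" using assms(2) s1 by (simp add: x_def s_def)
    then have "x * (1 + x) \<le> x * (3 / 2)" using True by (intro mult_left_mono) auto
    then show ?thesis using assms(2) by (simp add: x_def s_def)
  next
    case False
    have "x * (1 + x / 4) \<le> 0" using False x1 by (intro mult_nonpos_nonneg) auto
    moreover have "x\<^sup>2 \<le> s" using s by simp
    ultimately show ?thesis by (simp add: power2_eq_square algebra_simps)
  qed
  then have "(1 + x) * (x * (1 + x) - 3 / 4 * s) \<le> 0"
    using x1 by (intro mult_nonneg_nonpos) auto
  moreover have "Re z + Re (z ^ 2) + Re (z ^ 3) / 4 + s / 4 = (1 + x) * (x * (1 + x) - 3 / 4 * s)"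
    by (simp add: s x_def power2_eq_square power3_eq_cube field_simps)
  ultimately show ?thesis by (simp add: s_def)
qed

text \<open>One term of a putative counterexample sequence, with the zeros and the critical points listed with multiplicity.
The bound \<open>199 / 200\<close> makes the constants below explicit; only its closeness to 1 matters.\<close>

locale far_critical_points =
  fixes n :: nat and f :: "complex poly" and a :: real and r \<zeta> :: "nat \<Rightarrow> complex"
  assumes n: "n \<ge> 2"
    and f_eq: "f = (\<Prod>i<n. [:- r i, 1:])"
    and f'_eq: "pderiv f = smult (of_nat n) (\<Prod>j<n - 1. [:- \<zeta> j, 1:])"
    and r_le: "\<And>i. i < n \<Longrightarrow> norm (r i) \<le> 1"
    and a: "199 / 200 \<le> a" "a \<le> 1"
    and fa: "poly f a = 0"
    and far: "\<And>j. j < n - 1 \<Longrightarrow> 1 \<le> norm (\<zeta> j - a)"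
begin

abbreviation N :: nat where "N \<equiv> n - 1"

definition u :: "nat \<Rightarrow> complex" where "u j = 1 / (a - \<zeta> j)"

lemma poly_f': "poly (pderiv f) z = n * (\<Prod>j<N. z - \<zeta> j)"
  by (simp add: f'_eq poly_prod)

lemma norm_poly_f': "norm (poly (pderiv f) z) = n * (\<Prod>j<N. norm (z - \<zeta> j))"
  by (simp add: poly_f' norm_mult prod_norm)

lemma outside_disk: "norm z \<ge> 1 \<Longrightarrow> n * norm (poly f z) \<le> 2 * norm z * norm (poly (pderiv f) z)"
  unfolding f_eq by (rule poly_le_pderiv_outside_disk[OF r_le])

text \<open>Gauss--Lucas: outside the unit disk a zero of \<open>f'\<close> would be a zero of \<open>f\<close>.\<close>

lemma crit_le: assumes "j < N" shows "norm (\<zeta> j) \<le> 1"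
proof (rule ccontr)
  assume c: "\<not> norm (\<zeta> j) \<le> 1"
  have "poly (pderiv f) (\<zeta> j) = 0"
    unfolding poly_f' using assms by (auto intro!: prod_zero)
  with outside_disk[of "\<zeta> j"] c have "n * norm (poly f (\<zeta> j)) \<le> 0"
    by simp
  then have "poly f (\<zeta> j) = 0"
    using n by (simp add: mult_le_0_iff)
  then obtain i where "i < n" "\<zeta> j = r i"
    by (auto simp: f_eq poly_prod)
  with r_le c show False by auto
qed

text \<open>Moving the excluded disk from centre \<open>1\<close> to centre \<open>a\<close> costs nothing inside the unit disk and
gains \<open>1 - a\<close>. Without this gain the inequality is \<open>1 \<le> norm (\<zeta> j - 1)\<close>.\<close>

lemma lens:
  assumes "j < N"
  shows "2 * Re (\<zeta> j) \<le> norm (\<zeta> j) ^ 2 - (1 - a)"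
proof -
  define x s where "x = Re (\<zeta> j)" and "s = norm (\<zeta> j) ^ 2"
  have s: "0 \<le> s" "s \<le> 1" using crit_le[OF assms] by (auto simp: s_def power_le_one)
  have "1 \<le> norm (\<zeta> j - a) ^ 2" using far[OF assms] by simp
  also have "norm (\<zeta> j - a) ^ 2 = s - 2 * a * x + a\<^sup>2"
    unfolding s_def x_def cmod_power2 by (simp add: power2_eq_square algebra_simps)
  finally have 1: "2 * a * x \<le> s + a\<^sup>2 - 1" by simp
  have "0 \<le> (1 - a) * (1 - s)" using s a by simp
  then have "a * (2 * x) \<le> a * (s - (1 - a))"
    using 1 by (simp add: algebra_simps power2_eq_square)
  then show ?thesis using a by (simp add: x_def s_def)
qed

lemma Re_crit_le: "j < N \<Longrightarrow> Re (\<zeta> j) \<le> 1 / 2"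
  using lens[of j] crit_le[of j] power_le_one[of "norm (\<zeta> j)" 2] a by simp

lemma dist_one_ge: assumes "j < N" shows "1 \<le> norm (1 - \<zeta> j)"
proof -
  have "norm (1 - \<zeta> j) ^ 2 = 1 - 2 * Re (\<zeta> j) + norm (\<zeta> j) ^ 2"
    unfolding cmod_power2 by (simp add: power2_eq_square algebra_simps)
  also have "\<dots> \<ge> 1" using lens[OF assms] a by linarith
  finally have "1\<^sup>2 \<le> norm (1 - \<zeta> j) ^ 2" by simp
  then show ?thesis by (rule power2_le_imp_le) auto
qed

lemma dist_ge: "j < N \<Longrightarrow> 1 \<le> norm (a - \<zeta> j)"
  using far[of j] by (simp add: norm_minus_commute)

lemma crit_ne [simp]: "j < N \<Longrightarrow> of_real a \<noteq> \<zeta> j"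
  using dist_ge[of j] by auto

lemma norm_u_le: "j < N \<Longrightarrow> norm (u j) \<le> 1"
  using dist_ge[of j] by (simp add: u_def norm_divide divide_simps)

lemma Re_u_ge: assumes "j < N" shows "1 / 4 \<le> Re (u j)"
proof -
  define x y where "x = Re (\<zeta> j)" and "y = Im (\<zeta> j)"
  have pos: "(a - x)\<^sup>2 + y\<^sup>2 > 0"
    using crit_ne[OF assms] complex_neq_0[of "a - \<zeta> j"] by (simp add: x_def y_def)
  have "norm (\<zeta> j) ^ 2 \<le> 1" using crit_le[OF assms] by (simp add: power_le_one)
  then have s: "x\<^sup>2 + y\<^sup>2 \<le> 1" by (simp add: cmod_power2 x_def y_def)
  have x: "x \<le> 1 / 2" using Re_crit_le[OF assms] by (simp add: x_def)
  have "a\<^sup>2 \<le> 1" using a by (simp add: power_le_one)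
  moreover have "(4 - 2 * a) * x \<le> (4 - 2 * a) * (1 / 2)"
    using x a by (intro mult_left_mono) auto
  ultimately have "(a - x)\<^sup>2 + y\<^sup>2 \<le> 4 * (a - x)"
    using s a by (simp add: power2_eq_square algebra_simps)
  then have "1 / 4 \<le> (a - x) / ((a - x)\<^sup>2 + y\<^sup>2)"
    using pos by (simp add: field_simps)
  then show ?thesis by (simp add: u_def Re_divide x_def y_def)
qed

lemma deriv_ratio: "poly (pderiv f) (of_real a - of_real t) = poly (pderiv f) a * (\<Prod>j<N. 1 - t * u j)"
proof -
  have "(\<Prod>j<N. of_real a - of_real t - \<zeta> j) = (\<Prod>j<N. (a - \<zeta> j) * (1 - t * u j))"
    by (intro prod.cong) (auto simp: u_def right_diff_distrib)
  then show ?thesis by (simp add: poly_f' prod.distrib)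
qed

lemma norm_deriv_a_ge: "n \<le> norm (poly (pderiv f) a)"
  unfolding norm_poly_f' using prod_mono[of "{..<N}" "\<lambda>_. 1" "\<lambda>j. norm (a - \<zeta> j)"] dist_ge
  by (simp add: mult_le_cancel_left1)

lemma deriv_a_ne [simp]: "poly (pderiv f) a \<noteq> 0"
  using norm_deriv_a_ge n by auto

text \<open>The function \<open>f\<close> on the segment from \<open>a\<close> to the left, normalised to have value 0 and derivative 1 at the start.\<close>

definition f_left :: "real \<Rightarrow> complex" where "f_left t = - poly f (of_real a - of_real t) / poly (pderiv f) a"

lemma f_left_0 [simp]: "f_left 0 = 0"
  by (simp add: f_left_def fa)

lemma f_left_deriv: "(f_left has_vector_derivative (\<Prod>j<N. 1 - t * u j)) (at t)"
proof -
  have "((\<lambda>z. - poly f (a - z) / poly (pderiv f) a) has_field_derivative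
      poly (pderiv f) (a - t) / poly (pderiv f) a) (at (complex_of_real t))"
    by (auto intro!: derivative_eq_intros)
  from has_vector_derivative_real_field[OF this]
  show ?thesis by (simp add: f_left_def[abs_def] deriv_ratio)
qed

section \<open>Concentration of the critical points at the origin\<close>

lemma norm_one_minus_tu_le:
  assumes "j < N" "0 \<le> t" "t \<le> 1 / 4"
  shows "norm (1 - t * u j) \<le> exp (- (t / 8))"
proof (rule power2_le_imp_le)
  have "norm (1 - t * u j) ^ 2 = 1 - 2 * t * Re (u j) + t\<^sup>2 * norm (u j) ^ 2"
    unfolding cmod_power2 by (simp add: power2_eq_square algebra_simps)
  also have "\<dots> \<le> 1 - 2 * t * (1 / 4) + t\<^sup>2 * 1"
    using Re_u_ge[OF assms(1)] norm_u_le[OF assms(1)] assms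
    by (intro add_mono diff_mono mult_left_mono) (auto simp: power_le_one)
  also have "t\<^sup>2 \<le> t / 4" using assms mult_left_mono[of t "1/4" t] by (simp add: power2_eq_square)
  also have "1 - 2 * t * (1 / 4) + t / 4 * 1 \<le> exp (- (t / 4))"
    using exp_ge_add_one_self[of "- (t / 4)"] by simp
  also have "\<dots> = exp (- (t / 8)) ^ 2" by (simp flip: exp_of_nat_mult)
  finally show "norm (1 - t * u j) ^ 2 \<le> exp (- (t / 8)) ^ 2" by simp
qed auto

text \<open>The derivative of \<open>f_left\<close> is a product of factors \<open>1 - t * u j\<close>, which is close to
\<open>exp (- t * c)\<close> with \<open>c\<close> the sum of the \<open>u j\<close> as long as \<open>t\<close> is of order \<open>1 / N\<close>, and
negligible afterwards because \<open>Re (u j)\<close> is bounded below. The integral of \<open>exp (- t * c)\<close> is about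
\<open>1 / c\<close>, and \<open>norm c \<le> N\<close>; the error is \<open>O(1 / N\<^sup>2)\<close>.\<close>

lemma laplace_lower_bound:
  assumes large: "N \<ge> 2000000"
  shows "norm (f_left (1 / 4)) \<ge> 1 / (2 * N)"
proof -
  define c where "c = (\<Sum>j<N. u j)"
  \<comment> \<open>the difference of \<open>f_left\<close> and its exponential model; the derivatives differ by \<open>O(N * t\<^sup>2)\<close>
    times an exponentially decaying factor\<close>
  define h where "h t = f_left t - (1 - exp (- t * c)) / c" for t :: real
  have Rec: "Re c \<ge> N / 4"
    using sum_mono[of "{..<N}" "\<lambda>_. 1 / 4" "\<lambda>j. Re (u j)"] Re_u_ge by (simp add: c_def)
  have cN: "norm c \<le> N"
    using sum_norm_le[of "{..<N}" u "\<lambda>_. 1"] norm_u_le by (simp add: c_def)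
  have c0: "c \<noteq> 0" using Rec large by auto
  have "norm (h (1 / 4) - h 0) \<le> 2 * (2 * real N) / ((real N - 1) / 8) ^ 3"
  proof (rule quadratic_exp_derivative_bound)
    fix t :: real
    have "((\<lambda>z. (1 - exp (- z * c)) / c) has_field_derivative exp (- t * c)) (at (complex_of_real t))"
      using c0 by (auto intro!: derivative_eq_intros)
    from has_vector_derivative_real_field[OF this]
    show "(h has_vector_derivative (\<Prod>j<N. 1 - t * u j) - exp (- t * c)) (at t)"
      unfolding h_def by (intro has_vector_derivative_diff f_left_deriv) auto
    assume t: "0 < t" "t < 1 / 4"
    define q where "q = exp (- (t / 8))"
    have "norm ((\<Prod>j<N. 1 - t * u j) - (\<Prod>j<N. exp (- t * u j)))
        \<le> q ^ N / q * (\<Sum>j<N. norm (1 - t * u j - exp (- t * u j)))"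
    proof (rule norm_prod_diff_scaled)
      fix j assume j: "j < N"
      show "norm (1 - t * u j) \<le> q" unfolding q_def using j t by (intro norm_one_minus_tu_le) auto
      have "t * Re (u j) \<ge> t * (1 / 8)" using t Re_u_ge[OF j] by (intro mult_left_mono) auto
      then show "norm (exp (- t * u j)) \<le> q" by (simp add: q_def)
    qed (simp add: q_def)
    also have "\<dots> \<le> q ^ N / q * (\<Sum>j<N. 2 * t\<^sup>2)"
    proof (rule mult_left_mono[OF sum_mono])
      fix j assume "j \<in> {..<N}"
      then have nu: "norm (u j) \<le> 1" using norm_u_le by simp
      have "norm (- t * u j) = t * norm (u j)" using t by (simp add: norm_mult)
      also have "\<dots> \<le> t * 1" using t nu by (intro mult_left_mono) auto
      finally have tu: "norm (- t * u j) \<le> t" by simp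
      then have "norm (exp (- t * u j) - (1 + (- t * u j))) \<le> 2 * norm (- t * u j) ^ 2"
        using t by (intro norm_exp_minus_linear_le) auto
      also have "\<dots> \<le> 2 * t\<^sup>2" using tu by (intro mult_left_mono power_mono) auto
      finally show "norm (1 - t * u j - exp (- t * u j)) \<le> 2 * t\<^sup>2"
        by (simp add: norm_minus_commute)
    qed (simp add: q_def)
    also have "q ^ N / q * (\<Sum>j<N. 2 * t\<^sup>2) = 2 * real N * t\<^sup>2 * q ^ (N - 1)"
      using large by (cases N) (auto simp: q_def)
    also have "q ^ (N - 1) = exp (- ((real N - 1) / 8) * t)"
      using large by (simp add: q_def field_simps of_nat_diff flip: exp_of_nat_mult)
    also have "(\<Prod>j<N. exp (- t * u j)) = exp (- t * c)"
      by (simp only: c_def sum_distrib_left exp_sum finite_lessThan)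
    finally show "norm ((\<Prod>j<N. 1 - t * u j) - exp (- t * c)) \<le>
        2 * real N * t\<^sup>2 * exp (- ((real N - 1) / 8) * t)"
      by simp
  qed (use large in auto)
  also have "\<dots> \<le> 1 / (8 * real N)"
  proof -
    define x where "x = real N - 1"
    have x: "x \<ge> 1000000" using large by (simp add: x_def)
    have "16384 * (x + 1)\<^sup>2 \<le> 16384 * (2 * x)\<^sup>2" using x by (intro mult_left_mono power_mono) auto
    also have "\<dots> = 65536 * x\<^sup>2" by simp
    also have "\<dots> \<le> x * x\<^sup>2" using x by (intro mult_right_mono) auto
    finally have "16384 * (x + 1)\<^sup>2 \<le> x ^ 3" by (simp add: power3_eq_cube power2_eq_square)
    moreover have "real N = x + 1" by (simp add: x_def)
    ultimately show ?thesis using x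
      by (simp add: field_simps power2_eq_square power3_eq_cube)
  qed
  finally have err: "norm (h (1 / 4)) \<le> 1 / (8 * real N)"
    by (simp add: h_def)
  have "exp (- (real N / 16)) \<le> 1 / 4"
  proof -
    have "4 \<le> exp (real N / 16)"
      using exp_ge_add_one_self[of "real N / 16"] large by linarith
    then show ?thesis by (simp add: exp_minus field_simps)
  qed
  moreover have "norm (exp (- (1 / 4) * c)) \<le> exp (- (real N / 16))"
    using Rec by simp
  ultimately have "3 / 4 \<le> 1 - norm (exp (- (1 / 4) * c))" by linarith
  also have "\<dots> \<le> norm (1 - exp (- (1 / 4) * c))"
    by (metis norm_one norm_triangle_ineq2)
  finally have "3 / 4 / real N \<le> norm (1 - exp (- (1 / 4) * c)) / norm c"
    using cN c0 by (intro frac_le) auto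
  also have "\<dots> = norm (f_left (1 / 4) - h (1 / 4))"
    by (simp add: h_def norm_divide)
  also have "\<dots> \<le> norm (f_left (1 / 4)) + norm (h (1 / 4))" by (rule norm_triangle_ineq4)
  finally have main: "norm (f_left (1 / 4)) \<ge> 3 / 4 / real N - 1 / (8 * real N)"
    using err by (intro order_trans[OF diff_left_mono[OF err]]) (simp only: diff_le_eq)
  have "1 / (2 * x) \<le> 3 / 4 / x - 1 / (8 * x)" if "x > 0" for x :: real
    using that by (simp add: field_simps)
  moreover have "real N > 0" using large by simp
  ultimately have "1 / (2 * real N) \<le> 3 / 4 / real N - 1 / (8 * real N)" by blast
  then have "1 / (2 * real N) \<le> norm (f_left (1 / 4))"
    using main by (rule order_trans)
  then show ?thesis by simp
qed

text \<open>The segment from \<open>z\<close> to \<open>p = a - 1 / 4\<close> runs towards all critical points at once, so \<open>norm (f')\<close> is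
largest at its end \<open>z\<close>. Therefore \<open>norm (f p)\<close> is at most \<open>norm (f z) + norm (f' z)\<close>, where the
first summand is controlled by the second because \<open>z\<close> lies on the unit circle.\<close>

lemma deriv_on_circle_ge:
  fixes z :: complex
  assumes large: "N \<ge> 2000000" and z: "norm z = 1" "norm (z - 1) \<le> 1 / 200"
  shows "norm (poly (pderiv f) a) \<le> 4 * N * norm (poly (pderiv f) z)"
proof -
  define p where "p = complex_of_real (a - 1 / 4)"
  define e where "e = z - of_real a"
  define w where "w = z - p"
  have "norm e \<le> norm (z - 1) + norm (1 - complex_of_real a)"
    unfolding e_def using norm_triangle_ineq[of "z - 1" "1 - of_real a"] by simp
  also have "norm (1 - complex_of_real a) = 1 - a"
    using a by (metis abs_of_nonneg diff_ge_0_iff_ge norm_of_real of_real_1 of_real_diff)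
  finally have e: "norm e \<le> 1 / 100" using z a by linarith
  have we: "w = of_real (1 / 4) + e" by (simp add: w_def e_def p_def)
  have w2: "norm w ^ 2 \<le> (13 / 50) ^ 2"
    using norm_triangle_ineq[of "of_real (1 / 4)" e] e by (intro power_mono) (auto simp: we)
  \<comment> \<open>all factors of \<open>f'\<close> are at most their values at \<open>z\<close>, because \<open>w\<close> points away from every \<open>\<zeta> j\<close>\<close>
  have descent: "norm (poly (pderiv f) x) \<le> norm (poly (pderiv f) z)" if "x \<in> closed_segment z p" for x
  proof -
    obtain t where t: "0 \<le> t" "t \<le> 1" "x = (1 - t) *\<^sub>R z + t *\<^sub>R p"
      using \<open>x \<in> closed_segment z p\<close> by (auto simp: closed_segment_def)
    have x: "x = z - t * w" by (simp add: t w_def scaleR_conv_of_real algebra_simps)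
    have "norm (x - \<zeta> j) \<le> norm (z - \<zeta> j)" if j: "j < N" for j
    proof -
      define d where "d = z - \<zeta> j"
      have "Re z \<ge> 199 / 200" using abs_Re_le_cmod[of "z - 1"] z by simp
      then have Red: "Re d \<ge> 49 / 100" using Re_crit_le[OF j] by (simp add: d_def)
      have d2: "norm d \<le> 2"
        unfolding d_def using norm_triangle_ineq4[of z "\<zeta> j"] z crit_le[OF j] by simp
      have "Re (cnj e * d) \<ge> - (norm e * norm d)"
        using abs_Re_le_cmod[of "cnj e * d"] by (simp add: norm_mult)
      moreover have "norm e * norm d \<le> 1 / 100 * 2" using e d2 by (intro mult_mono) auto
      moreover have "Re (cnj w * d) = Re d / 4 + Re (cnj e * d)" by (simp add: we algebra_simps)
      ultimately have inner: "Re (cnj w * d) \<ge> 1 / 10" using Red by linarith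
      have "norm (x - \<zeta> j) ^ 2 = norm (d - t * w) ^ 2" by (simp add: x d_def algebra_simps)
      also have "\<dots> = norm d ^ 2 - t * (2 * Re (cnj w * d) - t * norm w ^ 2)"
        unfolding cmod_power2 by (simp add: power2_eq_square algebra_simps)
      also have "\<dots> \<le> norm d ^ 2"
      proof -
        have "t * norm w ^ 2 \<le> 1 * (13 / 50) ^ 2" using t w2 by (intro mult_mono) auto
        then have "2 * Re (cnj w * d) - t * norm w ^ 2 \<ge> 0"
          using inner by (simp add: power2_eq_square)
        then show ?thesis using t by simp
      qed
      finally show ?thesis unfolding d_def by (rule power2_le_imp_le) auto
    qed
    then show ?thesis unfolding norm_poly_f'
      by (intro mult_left_mono prod_mono) auto
  qed
  have "norm (poly f z - poly f p) \<le> norm (poly (pderiv f) z) * norm (z - p)"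
    by (rule field_differentiable_bound[OF convex_closed_segment])
       (auto intro!: descent derivative_eq_intros)
  also have "\<dots> \<le> norm (poly (pderiv f) z) * 1"
  proof (intro mult_left_mono)
    show "norm (z - p) \<le> 1"
      using norm_triangle_ineq[of "of_real (1 / 4)" e] e we by (auto simp: w_def)
  qed auto
  finally have "norm (poly f p) \<le> norm (poly f z) + norm (poly (pderiv f) z)"
    using norm_triangle_ineq2[of "poly f p" "poly f z"] by (simp add: norm_minus_commute)
  moreover have "norm (poly f z) \<le> norm (poly (pderiv f) z)"
  proof -
    have "2 * norm (poly f z) \<le> n * norm (poly f z)" using n by (intro mult_right_mono) auto
    also have "\<dots> \<le> 2 * norm (poly (pderiv f) z)" using outside_disk[of z] z by simp
    finally show ?thesis by simp
  qed
  moreover have "norm (poly f p) = norm (f_left (1 / 4)) * norm (poly (pderiv f) a)"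
    by (simp add: f_left_def p_def norm_divide)
  ultimately have "norm (f_left (1 / 4)) * norm (poly (pderiv f) a) \<le> 2 * norm (poly (pderiv f) z)"
    by simp
  moreover have "1 / (2 * N) * norm (poly (pderiv f) a) \<le> norm (f_left (1 / 4)) * norm (poly (pderiv f) a)"
    by (rule mult_right_mono[OF laplace_lower_bound[OF large]]) auto
  ultimately have "1 / (2 * N) * norm (poly (pderiv f) a) \<le> 2 * norm (poly (pderiv f) z)"
    by (rule order_trans[rotated])
  then show ?thesis using large by (simp add: field_simps)
qed

text \<open>Compare \<open>f' z * f' (cnj z)\<close> with \<open>f' a ^ 2\<close> from both sides: \<open>deriv_on_circle_ge\<close> loses only a factor
polynomial in \<open>N\<close>, and passing from \<open>a\<close> to 1 a factor \<open>exp (O(N * (1 - a)))\<close>, whereas by \<open>circle_pair_factor_le\<close> every critical point away from the origin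
loses a constant factor.\<close>

lemma sum_crit_squares_le:
  fixes z :: complex
  assumes large: "N \<ge> 2000000" and z: "norm z = 1" "norm (z - 1) \<le> 1 / 200" "z \<noteq> 1"
  shows "(\<Sum>j<N. norm (\<zeta> j) ^ 2) \<le> 16 / norm (z - 1) ^ 2 * (N * (1 - a) + ln (4 * N))"
proof -
  define \<epsilon> where "\<epsilon> = norm (z - 1) ^ 2"
  define q where "q j = (norm (\<zeta> j) / norm (1 - \<zeta> j)) ^ 2" for j
  define D where "D = norm (poly (pderiv f) a)"
  have D: "D > 0" by (simp add: D_def)
  have \<epsilon>: "\<epsilon> > 0" using z by (simp add: \<epsilon>_def)
  have "norm (cnj z - 1) = norm (z - 1)"
    by (metis complex_cnj_diff complex_cnj_one complex_mod_cnj)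
  then have "D * D \<le> (4 * N * norm (poly (pderiv f) z)) * (4 * N * norm (poly (pderiv f) (cnj z)))"
    unfolding D_def using z by (intro mult_mono deriv_on_circle_ge large) auto
  also have "\<dots> = (4 * N)\<^sup>2 * (n * n * (\<Prod>j<N. norm ((z - \<zeta> j) * (cnj z - \<zeta> j))))"
    by (simp add: norm_poly_f' norm_mult prod.distrib power2_eq_square)
  also have "\<dots> \<le> (4 * N)\<^sup>2 * (n * n * (\<Prod>j<N. norm (a - \<zeta> j) ^ 2 * exp (2 * (1 - a) - \<epsilon> / 2 * q j)))"
  proof (intro mult_left_mono prod_mono conjI)
    fix j assume "j \<in> {..<N}"
    then have j: "j < N" by simp
    have "norm (1 - \<zeta> j) \<le> norm (a - \<zeta> j) + norm (1 - complex_of_real a)"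
      using norm_triangle_ineq[of "a - \<zeta> j" "1 - of_real a"] by simp
    also have "norm (1 - complex_of_real a) = 1 - a"
      using a by (metis abs_of_nonneg diff_ge_0_iff_ge norm_of_real of_real_1 of_real_diff)
    also have "norm (a - \<zeta> j) + (1 - a) \<le> norm (a - \<zeta> j) * (1 + (1 - a))"
      using dist_ge[OF j] a mult_right_mono[of 1 "norm (a - \<zeta> j)" "1 - a"] by (simp add: algebra_simps)
    also have "\<dots> \<le> norm (a - \<zeta> j) * exp (1 - a)"
      by (intro mult_left_mono exp_ge_add_one_self) auto
    finally have "norm (1 - \<zeta> j) ^ 2 \<le> (norm (a - \<zeta> j) * exp (1 - a)) ^ 2"
      by (intro power_mono) auto
    also have "\<dots> = norm (a - \<zeta> j) ^ 2 * exp (2 * (1 - a))"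
      by (simp add: power_mult_distrib flip: exp_of_nat_mult)
    finally have sq: "norm (1 - \<zeta> j) ^ 2 \<le> norm (a - \<zeta> j) ^ 2 * exp (2 * (1 - a))" .
    have "norm ((z - \<zeta> j) * (cnj z - \<zeta> j)) \<le> norm (1 - \<zeta> j) ^ 2 * exp (- (\<epsilon> / 2 * q j))"
      unfolding \<epsilon>_def q_def using crit_le[OF j] dist_one_ge[OF j] z by (intro circle_pair_factor_le) auto
    also have "\<dots> \<le> (norm (a - \<zeta> j) ^ 2 * exp (2 * (1 - a))) * exp (- (\<epsilon> / 2 * q j))"
      by (intro mult_right_mono sq) auto
    also have "\<dots> = norm (a - \<zeta> j) ^ 2 * exp (2 * (1 - a) - \<epsilon> / 2 * q j)"
      by (simp add: mult.assoc flip: exp_add)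
    finally show "norm ((z - \<zeta> j) * (cnj z - \<zeta> j)) \<le> norm (a - \<zeta> j) ^ 2 * exp (2 * (1 - a) - \<epsilon> / 2 * q j)" .
  qed auto
  also have "\<dots> = D * D * ((4 * N)\<^sup>2 * exp (2 * real N * (1 - a) - \<epsilon> / 2 * (\<Sum>j<N. q j)))"
    by (simp add: D_def norm_poly_f' prod.distrib prod_power_distrib power2_eq_square
        sum_subtractf sum_distrib_left flip: exp_sum)
  finally have one_le: "1 \<le> (real (4 * N))\<^sup>2 * exp (2 * real N * (1 - a) - \<epsilon> / 2 * (\<Sum>j<N. q j))"
    using D by simp
  have "(real (4 * N))\<^sup>2 = exp (2 * ln (4 * N))"
    using large by (simp add: exp_double)
  then have "1 \<le> exp (2 * ln (4 * N) + (2 * real N * (1 - a) - \<epsilon> / 2 * (\<Sum>j<N. q j)))"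
    using one_le by (simp only: exp_add)
  then have "0 \<le> 2 * ln (4 * N) + (2 * real N * (1 - a) - \<epsilon> / 2 * (\<Sum>j<N. q j))"
    by (simp only: one_le_exp_iff)
  then have Q: "\<epsilon> * (\<Sum>j<N. q j) \<le> 4 * (N * (1 - a) + ln (4 * N))"
    by (simp add: algebra_simps)
  have "(\<Sum>j<N. norm (\<zeta> j) ^ 2) \<le> (\<Sum>j<N. 4 * q j)"
  proof (rule sum_mono)
    fix j assume "j \<in> {..<N}"
    then have j: "j < N" by simp
    have "norm (1 - \<zeta> j) \<le> 2" using norm_triangle_ineq4[of 1 "\<zeta> j"] crit_le[OF j] by simp
    then have "norm (\<zeta> j) / 2 \<le> norm (\<zeta> j) / norm (1 - \<zeta> j)"
      using dist_one_ge[OF j] by (intro divide_left_mono) auto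
    then have "(norm (\<zeta> j) / 2) ^ 2 \<le> q j" unfolding q_def by (intro power_mono) auto
    then show "norm (\<zeta> j) ^ 2 \<le> 4 * q j" by (simp add: power_divide)
  qed
  also have "\<dots> = 4 / \<epsilon> * (\<epsilon> * (\<Sum>j<N. q j))" using \<epsilon> by (simp add: sum_distrib_left)
  also have "\<dots> \<le> 4 / \<epsilon> * (4 * (N * (1 - a) + ln (4 * N)))"
    using Q \<epsilon> by (intro mult_left_mono) auto
  finally show ?thesis by (simp add: \<epsilon>_def)
qed

definition mean_crit :: real where "mean_crit = (\<Sum>j<N. norm (\<zeta> j)) / N"

lemma mean_crit_ge_0: "0 \<le> mean_crit"
  unfolding mean_crit_def by (intro divide_nonneg_nonneg sum_nonneg) auto

lemma mean_square_le: "N * mean_crit\<^sup>2 \<le> (\<Sum>j<N. norm (\<zeta> j) ^ 2)"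
proof -
  have N0: "real N > 0" using n by simp
  have "(\<Sum>j<N. norm (\<zeta> j) * 1)\<^sup>2 \<le> (\<Sum>j<N. norm (\<zeta> j) ^ 2) * (\<Sum>j<N. 1\<^sup>2)"
    by (rule Cauchy_Schwarz_ineq_sum)
  then have "(mean_crit * N)\<^sup>2 \<le> (\<Sum>j<N. norm (\<zeta> j) ^ 2) * N" using N0 by (simp add: mean_crit_def)
  then have "N * mean_crit\<^sup>2 * N \<le> (\<Sum>j<N. norm (\<zeta> j) ^ 2) * N" by (simp add: power2_eq_square mult_ac)
  then show ?thesis using N0 by (rule mult_right_le_imp_le)
qed

lemma mean_square_small:
  fixes z :: complex
  assumes "N \<ge> 2000000" "norm z = 1" "norm (z - 1) \<le> 1 / 200" "z \<noteq> 1"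
  shows "mean_crit\<^sup>2 \<le> 16 / norm (z - 1) ^ 2 * ((1 - a) + ln (4 * (real n - 1)) / (real n - 1))"
proof -
  have N0: "real N > 0" using n by simp
  have "N * mean_crit\<^sup>2 \<le> 16 / norm (z - 1) ^ 2 * (N * (1 - a) + ln (4 * N))"
    using mean_square_le sum_crit_squares_le[OF assms] by (rule order_trans)
  also have "\<dots> = N * (16 / norm (z - 1) ^ 2 * ((1 - a) + ln (4 * N) / N))"
    using N0 by (simp only: distrib_left times_divide_eq_right) simp
  finally have "mean_crit\<^sup>2 \<le> 16 / norm (z - 1) ^ 2 * ((1 - a) + ln (4 * N) / N)"
    using N0 by (rule mult_left_le_imp_le)
  then show ?thesis using n by (simp add: of_nat_diff)
qed

section \<open>Exponential smallness of the distance from the zero to the unit circle\<close>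

text \<open>The two numbers have the same argument, and moduli \<open>norm z ^ k\<close> and \<open>1 / norm z ^ k\<close>.\<close>

lemma norm_power_minus_reflection_le:
  fixes z :: complex
  assumes z: "1 / 2 \<le> norm z" "norm z \<le> 1" and k: "k \<le> 3"
  shows "norm (z ^ k - cnj ((1 / z) ^ k)) \<le> 48 * (1 - norm z)"
proof -
  define \<rho> where "\<rho> = norm z"
  have \<rho>: "1 / 2 \<le> \<rho>" "\<rho> \<le> 1" using z by (auto simp: \<rho>_def)
  have z0: "z \<noteq> 0" using z by auto
  have "z ^ k - cnj ((1 / z) ^ k) = (z ^ k * cnj z ^ k - 1) / cnj z ^ k"
    using z0 by (simp add: field_simps)
  also have "z ^ k * cnj z ^ k = of_real (\<rho> ^ (2 * k))"
    by (simp add: \<rho>_def power_mult flip: power_mult_distrib complex_norm_square)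
  finally have "norm (z ^ k - cnj ((1 / z) ^ k)) = norm (complex_of_real (\<rho> ^ (2 * k) - 1)) / \<rho> ^ k"
    by (simp add: norm_divide norm_power \<rho>_def)
  also have "norm (complex_of_real (\<rho> ^ (2 * k) - 1)) = 1 - \<rho> ^ (2 * k)"
    unfolding norm_of_real using \<rho> by (simp add: power_le_one)
  also have "\<dots> \<le> 6 * (1 - \<rho>)"
  proof -
    have "1 + real (2 * k) * (\<rho> - 1) \<le> (1 + (\<rho> - 1)) ^ (2 * k)"
      using \<rho> by (intro Bernoulli_inequality) auto
    then have "1 - \<rho> ^ (2 * k) \<le> real (2 * k) * (1 - \<rho>)" by (simp add: algebra_simps)
    also have "\<dots> \<le> 6 * (1 - \<rho>)" using k \<rho> by (intro mult_right_mono) auto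
    finally show ?thesis .
  qed
  also have "6 * (1 - \<rho>) / \<rho> ^ k \<le> 6 * (1 - \<rho>) / (1 / 2) ^ 3"
  proof (intro divide_left_mono mult_pos_pos)
    have "(1 / 2 :: real) ^ 3 \<le> (1 / 2) ^ k" using k by (intro power_decreasing) auto
    also have "\<dots> \<le> \<rho> ^ k" using \<rho> by (intro power_mono) auto
    finally show "(1 / 2) ^ 3 \<le> \<rho> ^ k" .
  qed (use \<rho> in auto)
  finally show ?thesis using \<rho> by (simp add: \<rho>_def divide_right_mono power3_eq_cube)
qed

text \<open>The value at \<open>t = a\<close> of \<open>f_left\<close> is \<open>- f 0 / f' a\<close>. Replacing each \<open>u j\<close> by the mean \<open>v\<close>
turns it into \<open>(1 - (1 - a * v) ^ n) / (n * v)\<close>, which has modulus at least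
\<open>(1 - mean_crit ^ n) / n\<close> because \<open>norm v \<le> 1\<close> and
\<open>norm (1 - a * v) \<le> mean_crit\<close>; and \<open>norm (f' a) \<ge> n\<close>. Comparing with the mean of
the \<open>u j\<close>, rather than with an exponential as in \<open>laplace_lower_bound\<close>, makes the error quadratic in the
deviations of the critical points and keeps the estimate valid on the whole segment down to 0.\<close>

lemma norm_f_0_ge:
  assumes large: "N \<ge> 10000000" and h: "mean_crit \<le> 1 / 300"
  shows "1 - mean_crit ^ n - 256 * mean_crit\<^sup>2 \<le> norm (poly f 0)"
proof -
  have N0: "real N > 0" using large by simp
  then have Nc: "of_nat N \<noteq> (0::complex)" by simp
  define v where "v = (\<Sum>j<N. u j) / N"
  define V where "V = (\<Sum>j<N. norm (v - u j)) / N"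
  have mean: "norm (\<Sum>j<N. g j) / N \<le> c * mean_crit" if "\<And>j. j < N \<Longrightarrow> norm (g j) \<le> c * norm (\<zeta> j)" for g :: "nat \<Rightarrow> complex" and c
  proof -
    have "norm (\<Sum>j<N. g j) \<le> (\<Sum>j<N. c * norm (\<zeta> j))"
      using that by (intro sum_norm_le) auto
    then show ?thesis using N0 by (simp add: mean_crit_def sum_distrib_left[symmetric] divide_right_mono)
  qed
  have u_dist: "norm (u j - 1 / a) \<le> 2 * norm (\<zeta> j)" if j: "j < N" for j
  proof -
    have "u j - 1 / a = \<zeta> j / (a * (a - \<zeta> j))"
      using crit_ne[OF j] a by (simp add: u_def field_simps)
    then have "norm (u j - 1 / a) = norm (\<zeta> j) / (a * norm (a - \<zeta> j))"
      using a by (simp add: norm_divide norm_mult)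
    also have "\<dots> \<le> norm (\<zeta> j) / (1 / 2 * 1)"
      using a dist_ge[OF j] by (intro divide_left_mono mult_mono mult_pos_pos) auto
    finally show ?thesis by simp
  qed
  have "v - 1 / a = (\<Sum>j<N. u j - 1 / a) / N"
    using Nc by (simp only: sum_subtractf sum_constant card_lessThan diff_divide_distrib v_def
        nonzero_mult_div_cancel_left not_False_eq_True)
  then have va: "norm (v - 1 / a) \<le> 2 * mean_crit"
    using mean[OF u_dist] by (simp add: norm_divide)
  have "1 - a * v = (\<Sum>j<N. 1 - a * u j) / N"
    using N0 by (simp add: v_def sum_subtractf diff_divide_distrib sum_distrib_left)
  moreover have "norm (1 - a * u j) \<le> 1 * norm (\<zeta> j)" if j: "j < N" for j
  proof -
    have "1 - a * u j = - \<zeta> j / (a - \<zeta> j)" using crit_ne[OF j] by (simp add: u_def field_simps)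
    then have "norm (1 - a * u j) = norm (\<zeta> j) / norm (a - \<zeta> j)" by (simp add: norm_divide)
    also have "\<dots> \<le> norm (\<zeta> j) / 1" using dist_ge[OF j] by (intro divide_left_mono) auto
    finally show ?thesis by simp
  qed
  ultimately have av: "norm (1 - a * v) \<le> mean_crit"
    using mean[of "\<lambda>j. 1 - a * u j" 1] by (simp add: norm_divide)
  have "norm (1 / complex_of_real a - 1) = 1 / a - 1"
  proof -
    have "1 / complex_of_real a - 1 = of_real (1 / a - 1)" by simp
    moreover have "1 / a - 1 \<ge> 0" using a by simp
    ultimately show ?thesis by (metis abs_of_nonneg norm_of_real)
  qed
  also have "\<dots> \<le> 1 / 100" using a by (simp add: field_simps)
  finally have v1: "norm (1 - v) \<le> 1 / 100 + 2 * mean_crit"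
    using va norm_triangle_ineq[of "v - 1 / a" "1 / a - 1"] by (simp add: norm_minus_commute)
  have v0: "v \<noteq> 0" using v1 h by auto
  have "norm (\<Sum>j<N. u j) \<le> (\<Sum>j<N. 1)" by (intro sum_norm_le norm_u_le) auto
  then have "norm (\<Sum>j<N. u j) \<le> real N" by simp
  then have vle: "norm v \<le> 1"
    unfolding v_def norm_divide norm_of_nat using N0 by (simp only: divide_le_eq_1_pos)
  have "(\<Sum>j<N. norm (v - u j)) \<le> (\<Sum>j<N. 2 * mean_crit + 2 * norm (\<zeta> j))"
  proof (rule sum_mono)
    fix j assume "j \<in> {..<N}"
    then show "norm (v - u j) \<le> 2 * mean_crit + 2 * norm (\<zeta> j)"
      using va u_dist[of j] norm_triangle_ineq4[of "v - 1 / a" "u j - 1 / a"] by simp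
  qed
  also have "\<dots> = 4 * mean_crit * N"
    using N0 by (simp add: sum.distrib mean_crit_def flip: sum_distrib_left)
  finally have V: "V \<le> 4 * mean_crit" using N0 by (simp add: V_def field_simps)
  have V0: "0 \<le> V" unfolding V_def by (intro divide_nonneg_nonneg sum_nonneg) auto
  \<comment> \<open>the difference of \<open>f_left\<close> and its model with all \<open>u j\<close> replaced by \<open>v\<close>\<close>
  define H where "H t = f_left t - (1 - (1 - t * v) ^ n) / (n * v)" for t :: real
  have "norm (H a - H 0) \<le> 2 * (8 * real N ^ 2 * mean_crit\<^sup>2) / ((real N - 2) / 2) ^ 3"
  proof (rule quadratic_exp_derivative_bound)
    fix t :: real
    have "((\<lambda>z. (1 - (1 - z * v) ^ n) / (n * v)) has_field_derivative (1 - t * v) ^ N) (at (complex_of_real t))"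
      using v0 n by (auto intro!: derivative_eq_intros)
    from has_vector_derivative_real_field[OF this]
    show "(H has_vector_derivative (\<Prod>j<N. 1 - t * u j) - (1 - t * v) ^ N) (at t)"
      unfolding H_def by (intro has_vector_derivative_diff f_left_deriv) auto
    assume t: "0 < t" "t < a"
    then have t1: "t \<le> 1" using a by simp
    have "(\<Sum>j<N. t * (v - u j)) = 0"
      using N0 by (simp add: sum_subtractf v_def flip: sum_distrib_left)
    note mean_zero = this
    have factor: "1 - t * v + t * (v - u j) = 1 - t * u j" for j by (simp add: algebra_simps)
    have "(\<Sum>j<N. norm (t * (v - u j))) = t * (\<Sum>j<N. norm (v - u j))"
      using t by (simp add: norm_mult sum_distrib_left)
    then have deviation: "(\<Sum>j<N. norm (t * (v - u j))) / N = t * V" by (simp add: V_def)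
    have "norm ((\<Prod>j<N. 1 - t * u j) - (1 - t * v) ^ N)
        \<le> real N ^ 2 / 2 * (t * V)\<^sup>2 * (norm (1 - t * v) + t * V) ^ (N - 2)"
      using norm_prod_minus_mean_power[OF mean_zero, of "1 - t * v"] large
      unfolding factor deviation by simp
    also have "\<dots> \<le> real N ^ 2 / 2 * (t * (4 * mean_crit))\<^sup>2 * exp (- (t / 2)) ^ (N - 2)"
    proof (intro mult_mono power_mono mult_left_mono V)
      have "norm (1 - t * v) = norm (of_real (1 - t) + t * (1 - v))" by (simp add: algebra_simps)
      also have "\<dots> \<le> norm (complex_of_real (1 - t)) + norm (t * (1 - v))"
        by (rule norm_triangle_ineq)
      also have "\<dots> = (1 - t) + t * norm (1 - v)"
        unfolding norm_of_real norm_mult using t t1 by simp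
      finally have "norm (1 - t * v) + t * V \<le> 1 - t + t * (norm (1 - v) + V)"
        by (simp add: algebra_simps)
      also have "t * (norm (1 - v) + V) \<le> t * (1 / 2)"
        using v1 V h t by (intro mult_left_mono) auto
      also have "1 - t + t * (1 / 2) \<le> exp (- (t / 2))"
        using exp_ge_add_one_self[of "- (t / 2)"] by simp
      finally show "norm (1 - t * v) + t * V \<le> exp (- (t / 2))" by simp
    qed (use t V0 mean_crit_ge_0 in auto)
    also have "exp (- (t / 2)) ^ (N - 2) = exp (- ((real N - 2) / 2) * t)"
      using large by (simp add: of_nat_diff field_simps flip: exp_of_nat_mult)
    finally show "norm ((\<Prod>j<N. 1 - t * u j) - (1 - t * v) ^ N)
        \<le> 8 * real N ^ 2 * mean_crit\<^sup>2 * t\<^sup>2 * exp (- ((real N - 2) / 2) * t)"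
      by (simp add: power_mult_distrib mult_ac)
  qed (use large a in auto)
  also have "H 0 = 0" by (simp add: H_def)
  finally have err: "norm (H a) \<le> 128 * real N ^ 2 * mean_crit\<^sup>2 / (real N - 2) ^ 3"
    by (simp add: power_divide)
  have "n * (128 * real N ^ 2 * mean_crit\<^sup>2 / (real N - 2) ^ 3) \<le> 256 * mean_crit\<^sup>2"
  proof -
    define x where "x = real N - 2"
    have x: "x \<ge> 1000" using large by (simp add: x_def)
    have "real n * real N ^ 2 \<le> (101 / 100 * x) * (101 / 100 * x) ^ 2"
      using x n by (intro mult_mono power_mono) (auto simp: x_def of_nat_diff)
    also have "\<dots> \<le> 2 * x ^ 3" using x by (simp add: power2_eq_square power3_eq_cube)
    finally have "real n * real N ^ 2 / x ^ 3 \<le> 2" using x by (simp add: divide_le_eq)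
    then have "128 * mean_crit\<^sup>2 * (real n * real N ^ 2 / x ^ 3) \<le> 128 * mean_crit\<^sup>2 * 2"
      by (intro mult_left_mono) auto
    then show ?thesis by (simp add: x_def mult_ac)
  qed
  moreover have "n * norm (H a) \<le> n * (128 * real N ^ 2 * mean_crit\<^sup>2 / (real N - 2) ^ 3)"
    by (intro mult_left_mono err) auto
  ultimately have err': "n * norm (H a) \<le> 256 * mean_crit\<^sup>2" by linarith
  have "1 - mean_crit ^ n \<le> 1 - norm ((1 - a * v) ^ n)"
    using av by (simp add: norm_power power_mono)
  also have "\<dots> \<le> norm (1 - (1 - a * v) ^ n)" by (metis norm_one norm_triangle_ineq2)
  also have "\<dots> \<le> norm (1 - (1 - a * v) ^ n) / norm v"
    using vle v0 by (simp add: divide_simps mult_left_le)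
  also have "\<dots> = n * norm (f_left a - H a)"
    using n by (simp add: H_def norm_divide norm_mult)
  also have "\<dots> \<le> n * (norm (f_left a) + norm (H a))" by (intro mult_left_mono norm_triangle_ineq4) auto
  finally have "1 - mean_crit ^ n - 256 * mean_crit\<^sup>2 \<le> norm (f_left a) * n" using err' by (simp add: algebra_simps)
  also have "\<dots> \<le> norm (f_left a) * norm (poly (pderiv f) a)"
    by (intro mult_left_mono norm_deriv_a_ge) auto
  also have "\<dots> = norm (poly f 0)" by (simp add: f_left_def norm_divide)
  finally show ?thesis .
qed

text \<open>When the mean of \<open>norm (\<zeta> j)\<close> is small, so is the mean \<open>\<kappa> + mean_crit\<close> of the factors that majorise
the low coefficients of \<open>f'\<close>. The upper bound is therefore like a small number to the power \<open>N\<close>.\<close>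

lemma norm_coeff_f_le:
  assumes \<kappa>: "0 < \<kappa>" "\<kappa> \<le> 1" and k: "k \<in> {1, 2, 3}"
  shows "norm (coeff f k) \<le> n * (\<kappa> + mean_crit) ^ N / \<kappa> ^ 2"
proof -
  obtain m where m: "k = Suc m" "m \<le> 2" using k by (cases k) auto
  define Z where "Z = (\<Prod>j<N. [:- \<zeta> j, 1:])"
  have "norm (coeff Z m) * \<kappa> ^ 2 \<le> norm (coeff Z m) * \<kappa> ^ m"
    using \<kappa> m by (intro mult_left_mono power_decreasing) auto
  also have "\<dots> \<le> (\<Prod>j<N. \<kappa> + norm (\<zeta> j))"
    unfolding Z_def by (rule norm_coeff_linear_factors_le[OF \<kappa>(1)])
  also have "\<dots> \<le> ((\<Sum>j<N. \<kappa> + norm (\<zeta> j)) / N) ^ N"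
    using \<kappa> n by (intro prod_le_mean_power) auto
  also have "(\<Sum>j<N. \<kappa> + norm (\<zeta> j)) / N = \<kappa> + mean_crit"
    using n by (simp add: sum.distrib mean_crit_def add_divide_distrib)
  finally have Z: "norm (coeff Z m) \<le> (\<kappa> + mean_crit) ^ N / \<kappa> ^ 2"
    using \<kappa> by (simp add: field_simps)
  have "of_nat (Suc m) * coeff f k = of_nat n * coeff Z m"
    using arg_cong[OF f'_eq, of "\<lambda>p. coeff p m"] by (simp only: coeff_pderiv coeff_smult m(1) Z_def)
  then have "real (Suc m) * norm (coeff f k) = n * norm (coeff Z m)"
    by (metis norm_mult norm_of_nat)
  moreover have "1 * norm (coeff f k) \<le> real (Suc m) * norm (coeff f k)"
    by (intro mult_right_mono) auto
  ultimately have "norm (coeff f k) \<le> n * norm (coeff Z m)" by simp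
  also have "\<dots> \<le> n * ((\<kappa> + mean_crit) ^ N / \<kappa> ^ 2)" by (intro mult_left_mono Z) auto
  finally show ?thesis by simp
qed

text \<open>The power sums of the reciprocals \<open>1 / r i\<close> are polynomials in the low coefficients of \<open>f\<close> divided
by \<open>f 0\<close>. Since all \<open>norm (r i) \<le> 1\<close> and their product is close to 1, the zeros are close to the unit
circle in sum, where \<open>1 / r i\<close> is the conjugate of \<open>r i\<close>.\<close>

lemma root_power_sums_le:
  assumes x: "0 \<le> x" "x \<le> 1 / 4" "1 - x \<le> norm (poly f 0)"
    and d: "\<And>k. k \<in> {1, 2, 3} \<Longrightarrow> norm (coeff f k) \<le> d" "d \<le> 1 / 2"
    and k: "k \<in> {1, 2, 3}"
  shows "norm (\<Sum>i<n. r i ^ k) \<le> 96 * x + 14 * d"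
proof -
  have f0: "poly f 0 = (\<Prod>i<n. - r i)" by (simp add: f_eq poly_prod)
  then have "norm (poly f 0) = (\<Prod>i<n. norm (r i))" by (simp add: prod_norm[symmetric])
  then have defect: "(\<Sum>i<n. 1 - norm (r i)) \<le> 2 * x"
    using x by (intro prod_near_one) auto
  have r_ge: "1 / 2 \<le> norm (r i)" if i: "i < n" for i
  proof -
    have "1 - norm (r i) \<le> (\<Sum>i<n. 1 - norm (r i))"
      using i r_le by (intro member_le_sum) auto
    then show ?thesis using defect x by linarith
  qed
  have "norm (\<Sum>i<n. (1 / r i) ^ k) \<le> 7 * (2 * d)"
  proof (rule power_sums_small[OF _ _ k])
    fix k :: nat assume k: "k \<in> {1, 2, 3}"
    have "f = (\<Prod>i<n. smult (- r i) [:1, - (1 / r i):])"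
      unfolding f_eq
    proof (rule prod.cong)
      fix i assume "i \<in> {..<n}"
      then have "r i \<noteq> 0" using r_ge[of i] by auto
      then show "[:- r i, 1:] = smult (- r i) [:1, - (1 / r i):]" by simp
    qed simp
    also have "\<dots> = smult (poly f 0) (\<Prod>i<n. [:1, - (1 / r i):])"
      by (simp only: prod_smult f0)
    finally have "norm (coeff f k) = norm (poly f 0) * norm (coeff (\<Prod>i<n. [:1, - (1 / r i):]) k)"
      by (metis coeff_smult norm_mult)
    moreover have "1 / 2 * norm (coeff (\<Prod>i<n. [:1, - (1 / r i):]) k)
        \<le> norm (poly f 0) * norm (coeff (\<Prod>i<n. [:1, - (1 / r i):]) k)"
      using x by (intro mult_right_mono) auto
    ultimately show "norm (coeff (\<Prod>i<n. [:1, - (1 / r i):]) k) \<le> 2 * d"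
      using d(1)[OF k] by linarith
  qed (use d in simp)
  then have inv: "norm (cnj (\<Sum>i<n. (1 / r i) ^ k)) \<le> 14 * d"
    unfolding complex_mod_cnj by simp
  have "norm ((\<Sum>i<n. r i ^ k) - cnj (\<Sum>i<n. (1 / r i) ^ k)) \<le> (\<Sum>i<n. 48 * (1 - norm (r i)))"
    unfolding cnj_sum sum_subtractf[symmetric]
    using r_ge r_le k by (intro sum_norm_le norm_power_minus_reflection_le) auto
  also have "\<dots> \<le> 96 * x" unfolding sum_distrib_left[symmetric] using defect by linarith
  finally show ?thesis
    using inv norm_triangle_sub[of "\<Sum>i<n. r i ^ k" "cnj (\<Sum>i<n. (1 / r i) ^ k)"] by linarith
qed

text \<open>Differentiation multiplies the coefficient of degree \<open>n - k\<close> by \<open>n - k\<close>; after division by the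
leading coefficient \<open>n\<close> of \<open>f'\<close> the factor is \<open>(n - k) / n\<close>.\<close>

lemma norm_coeff_crit_le:
  assumes "k \<le> N"
  shows "norm (coeff (\<Prod>j<N. [:1, - \<zeta> j:]) k) \<le> norm (coeff (\<Prod>i<n. [:1, - r i:]) k)"
proof -
  define Z where "Z = (\<Prod>j<N. [:- \<zeta> j, 1:])"
  have k: "Suc (N - k) = n - k" using assms n by simp
  have "of_nat (n - k) * coeff f (n - k) = of_nat n * coeff Z (N - k)"
    using arg_cong[OF f'_eq, of "\<lambda>p. coeff p (N - k)"]
    by (simp only: coeff_pderiv coeff_smult k Z_def)
  then have "n * norm (coeff Z (N - k)) = real (n - k) * norm (coeff f (n - k))"
    by (metis norm_mult norm_of_nat)
  also have "\<dots> \<le> n * norm (coeff f (n - k))" by (intro mult_right_mono) auto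
  finally have "norm (coeff Z (N - k)) \<le> norm (coeff f (n - k))" using n by simp
  then show ?thesis
    using assms n by (simp only: coeff_reversed_linear_factors Z_def f_eq)
qed

text \<open>The sum \<open>s\<close> of the \<open>norm (\<zeta> j) ^ 2\<close> is bounded by the power sums of the critical points, which
are \<open>O(mean_crit\<^sup>2)\<close> up to exponentially small terms; and \<open>mean_crit\<^sup>2 \<le> s / N\<close>. For large \<open>N\<close> the term
with \<open>mean_crit\<^sup>2\<close> is absorbed, and only the exponentially small ones remain.\<close>

lemma gap_le:
  assumes large: "N \<ge> 10000000" and h: "mean_crit \<le> 1 / 300" and \<kappa>: "0 < \<kappa>" "\<kappa> \<le> 1"
  shows "1 - a \<le> 60000 * (mean_crit ^ n + n * (\<kappa> + mean_crit) ^ N / \<kappa> ^ 2)"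
proof -
  define d where "d = n * (\<kappa> + mean_crit) ^ N / \<kappa> ^ 2"
  have d0: "0 \<le> d" using \<kappa> mean_crit_ge_0 by (simp add: d_def)
  have hn: "0 \<le> mean_crit ^ n" using mean_crit_ge_0 by simp
  show ?thesis
  proof (cases "d \<le> 1 / 200")
    case False
    then have "60000 * (1 / 200) \<le> 60000 * (mean_crit ^ n + d)" using hn by (intro mult_left_mono) auto
    moreover have "1 - a \<le> 60000 * (1 / 200)" using a by simp
    ultimately have "1 - a \<le> 60000 * (mean_crit ^ n + d)" by (rule order_trans[rotated])
    then show ?thesis unfolding d_def .
  next
    case True
    define x where "x = mean_crit ^ n + 256 * mean_crit\<^sup>2"
    define y where "y = 96 * x + 14 * d"
    define s where "s = (\<Sum>j<N. norm (\<zeta> j) ^ 2)"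
    have N0: "real N > 0" using large by simp
    have h2: "mean_crit\<^sup>2 \<le> (1 / 300)\<^sup>2" using h mean_crit_ge_0 by (intro power_mono) auto
    have "mean_crit ^ n \<le> mean_crit ^ 2" using h mean_crit_ge_0 n by (intro power_decreasing) auto
    then have x: "0 \<le> x" "x \<le> 257 * (1 / 300)\<^sup>2" using h2 hn by (auto simp: x_def)
    have y: "0 \<le> y" "2 * y \<le> 1" using x True d0 by (auto simp: y_def power2_eq_square)
    have roots: "norm (\<Sum>i<n. r i ^ k) \<le> y" if "k \<in> {1, 2, 3}" for k
      unfolding y_def
    proof (rule root_power_sums_le[OF _ _ _ _ _ that])
      show "1 - x \<le> norm (poly f 0)" using norm_f_0_ge[OF large h] by (simp add: x_def)
      show "norm (coeff f k) \<le> d" if "k \<in> {1, 2, 3}" for k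
        unfolding d_def by (rule norm_coeff_f_le[OF \<kappa> that])
    qed (use x True in \<open>auto simp: power2_eq_square\<close>)
    have crit: "norm (\<Sum>j<N. \<zeta> j ^ k) \<le> 7 * (2 * y)" if "k \<in> {1, 2, 3}" for k
    proof (rule power_sums_small[OF _ y(2) that])
      fix k :: nat assume k: "k \<in> {1, 2, 3}"
      then have "norm (coeff (\<Prod>j<N. [:1, - \<zeta> j:]) k) \<le> norm (coeff (\<Prod>i<n. [:1, - r i:]) k)"
        using large by (intro norm_coeff_crit_le) auto
      also have "\<dots> \<le> 2 * y" using y k by (intro coeffs_small roots) auto
      finally show "norm (coeff (\<Prod>j<N. [:1, - \<zeta> j:]) k) \<le> 2 * y" .
    qed
    have Re_crit: "- (14 * y) \<le> Re (\<Sum>j<N. \<zeta> j ^ k)" if "k \<in> {1, 2, 3}" for k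
      using crit[OF that] abs_Re_le_cmod[of "\<Sum>j<N. \<zeta> j ^ k"] by linarith
    have "(\<Sum>j<N. Re (\<zeta> j) + Re (\<zeta> j ^ 2) + Re (\<zeta> j ^ 3) / 4) \<le> (\<Sum>j<N. - (norm (\<zeta> j) ^ 2 / 4))"
    proof (intro sum_mono lens_cubic_le)
      fix j assume "j \<in> {..<N}"
      then show "norm (\<zeta> j) \<le> 1" "2 * Re (\<zeta> j) \<le> norm (\<zeta> j) ^ 2"
        using crit_le[of j] lens[of j] a by auto
    qed
    also have "(\<Sum>j<N. - (norm (\<zeta> j) ^ 2 / 4)) = - (s / 4)"
      by (simp add: s_def sum_negf sum_divide_distrib)
    also have "(\<Sum>j<N. Re (\<zeta> j) + Re (\<zeta> j ^ 2) + Re (\<zeta> j ^ 3) / 4)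
        = Re (\<Sum>j<N. \<zeta> j ^ 1) + Re (\<Sum>j<N. \<zeta> j ^ 2) + Re (\<Sum>j<N. \<zeta> j ^ 3) / 4"
      by (simp add: sum.distrib sum_divide_distrib)
    finally have "s / 4 \<le> 14 * y + 14 * y + 14 * y / 4"
      using Re_crit[of 1] Re_crit[of 2] Re_crit[of 3] by simp
    then have s: "s \<le> 128 * y" using y by linarith
    have "(\<Sum>j<N. 1 - a) \<le> (\<Sum>j<N. norm (\<zeta> j) ^ 2 - 2 * Re (\<zeta> j))"
    proof (rule sum_mono)
      fix j assume "j \<in> {..<N}"
      then show "1 - a \<le> norm (\<zeta> j) ^ 2 - 2 * Re (\<zeta> j)" using lens[of j] by simp
    qed
    also have "\<dots> = s - 2 * Re (\<Sum>j<N. \<zeta> j ^ 1)"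
      by (simp add: s_def sum_subtractf sum_distrib_left)
    also have "\<dots> \<le> s + 28 * y" using Re_crit[of 1] by simp
    finally have gap: "N * (1 - a) \<le> s + 28 * y" by simp
    have "N * mean_crit\<^sup>2 \<le> s" unfolding s_def by (rule mean_square_le)
    moreover have "10000000 * mean_crit\<^sup>2 \<le> N * mean_crit\<^sup>2" using large by (intro mult_right_mono) auto
    ultimately have big: "10000000 * mean_crit\<^sup>2 \<le> s" by linarith
    \<comment> \<open>the coefficient of \<open>t = mean_crit\<^sup>2\<close> is below \<open>10000000\<close>, which is where the size of \<open>N\<close> comes from\<close>
    have collect: "X \<le> 60000 * (H + D)"
      if "10000000 * t \<le> S" "S \<le> 128 * (96 * (H + 256 * t) + 14 * D)"
        "X \<le> S + 28 * (96 * (H + 256 * t) + 14 * D)" "0 \<le> D" "0 \<le> H" for X S t H D :: real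
      using that by argo
    have "N * (1 - a) \<le> 60000 * (mean_crit ^ n + d)"
      by (rule collect[OF big s[unfolded y_def x_def] gap[unfolded y_def x_def] d0 hn])
    moreover have "1 * (1 - a) \<le> N * (1 - a)" using a large by (intro mult_right_mono) auto
    ultimately show ?thesis by (simp add: d_def)
  qed
qed

end

section \<open>The theorem on sequences\<close>

lemma far_critical_pointsI:
  fixes f :: "complex poly" and a :: real
  assumes n: "n \<ge> 2" and f: "degree f = n" "lead_coeff f = 1"
    and roots: "\<And>z. poly f z = 0 \<Longrightarrow> norm z \<le> 1"
    and a: "199 / 200 \<le> a" "a \<le> 1" "poly f a = 0"
    and no_crit: "\<not> (\<exists>z. norm (z - complex_of_real a) \<le> 1 \<and> poly (pderiv f) z = 0)"
  obtains r \<zeta> where "far_critical_points n f a r \<zeta>"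
proof -
  obtain r where r: "smult (lead_coeff f) (\<Prod>i<degree f. [:- r i, 1:]) = f"
    by (rule complex_poly_decompose')
  obtain \<zeta> where \<zeta>: "smult (lead_coeff (pderiv f)) (\<Prod>j<degree (pderiv f). [:- \<zeta> j, 1:]) = pderiv f"
    by (rule complex_poly_decompose')
  have deg: "degree (pderiv f) = n - 1" using f by (simp add: degree_pderiv)
  have "coeff f n = 1" using f by simp
  then have lead: "lead_coeff (pderiv f) = of_nat n"
    using n by (simp add: deg coeff_pderiv)
  have f_eq: "f = (\<Prod>i<n. [:- r i, 1:])" using r f by simp
  have f'_eq: "pderiv f = smult (of_nat n) (\<Prod>j<n - 1. [:- \<zeta> j, 1:])"
    using \<zeta> unfolding lead unfolding deg by (rule sym)
  have "far_critical_points n f a r \<zeta>"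
  proof
    show "norm (r i) \<le> 1" if "i < n" for i
      using that by (intro roots) (auto simp: f_eq poly_prod)
    show "1 \<le> norm (\<zeta> j - a)" if "j < n - 1" for j
    proof -
      have "poly (pderiv f) (\<zeta> j) = 0"
        unfolding f'_eq using that by (auto simp: poly_prod)
      then show ?thesis using no_crit by force
    qed
  qed (fact n a f_eq f'_eq)+
  then show ?thesis by (rule that)
qed

theorem theorem5p1:
  fixes N :: "nat \<Rightarrow> nat"
    and f :: "nat \<Rightarrow> complex poly"
    and a :: "nat \<Rightarrow> real"
    and \<epsilon>\<^sub>0 :: real
  assumes "filterlim N at_top sequentially"
    and "\<And>n. n \<in> range N \<Longrightarrow> degree (f n) = n"
    and "\<And>n. n \<in> range N \<Longrightarrow> lead_coeff (f n) = 1"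
    and "\<And>n z. n \<in> range N \<Longrightarrow> poly (f n) z = 0 \<Longrightarrow> cmod z \<le> 1"
    and "\<And>n. n \<in> range N \<Longrightarrow> a n \<in> {0..1}"
    and "\<And>n. n \<in> range N \<Longrightarrow> poly (f n) (complex_of_real (a n)) = 0"
    and "(\<lambda>k. a (N k)) \<longlonglongrightarrow> 1"
    and "\<epsilon>\<^sub>0 > 0"
    and "\<And>n. n \<in> range N \<Longrightarrow> a n \<le> 1 - \<epsilon>\<^sub>0 ^ n"
  shows "\<not> (\<forall>n \<in> range N. \<not> (\<exists>z. cmod (z - complex_of_real (a n)) \<le> 1 \<and> poly (pderiv (f n)) z = 0))"
proof
  assume no_crit: "\<forall>n \<in> range N. \<not> (\<exists>z. cmod (z - complex_of_real (a n)) \<le> 1 \<and> poly (pderiv (f n)) z = 0)"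
  define \<epsilon> where "\<epsilon> = min \<epsilon>\<^sub>0 1"
  \<comment> \<open>both \<open>\<kappa>\<close> and \<open>2 * \<kappa>\<close>, the bases of the exponential bounds on \<open>1 - a\<close>, are well below \<open>\<epsilon>\<close>\<close>
  define \<kappa> where "\<kappa> = \<epsilon> / 300"
  have \<epsilon>: "0 < \<epsilon>" "\<epsilon> \<le> 1" "\<epsilon> \<le> \<epsilon>\<^sub>0" using assms(8) by (auto simp: \<epsilon>_def)
  then have \<kappa>: "0 < \<kappa>" "\<kappa> \<le> 1 / 300" by (auto simp: \<kappa>_def)
  \<comment> \<open>any fixed point of the circle near 1, but different from it, would do\<close>
  define z where "z = cis (1 / 200)"
  have z_dist: "norm (z - 1) = 2 * \<bar>sin (1 / 400)\<bar>"
    using dist_exp_i_1[of "1 / 200"] by (simp add: z_def cis_conv_exp dist_norm)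
  have z: "norm z = 1" by (simp add: z_def)
  have z_near: "norm (z - 1) \<le> 1 / 200"
    unfolding z_dist using abs_sin_x_le_abs_x[of "1 / 400"] by simp
  have "sin (1 / 400 :: real) > 0" using pi_gt3 by (intro sin_gt_zero) auto
  then have z1: "z \<noteq> 1" using z_dist by auto
  define C where "C = 16 / norm (z - 1) ^ 2"
  have N_real: "filterlim (\<lambda>k. real (N k)) at_top sequentially"
    by (rule filterlim_compose[OF filterlim_real_sequentially assms(1)])
  have "((\<lambda>x::real. ln (4 * (x - 1)) / (x - 1)) \<longlongrightarrow> 0) at_top" by real_asymp
  then have "(\<lambda>k. ln (4 * (real (N k) - 1)) / (real (N k) - 1)) \<longlonglongrightarrow> 0"
    using N_real by (rule filterlim_compose)
  then have "(\<lambda>k. C * ((1 - a (N k)) + ln (4 * (real (N k) - 1)) / (real (N k) - 1))) \<longlonglongrightarrow> C * ((1 - 1) + 0)"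
    by (intro tendsto_intros assms(7))
  then have ev_h: "\<forall>\<^sub>F k in sequentially. C * ((1 - a (N k)) + ln (4 * (real (N k) - 1)) / (real (N k) - 1)) < \<kappa>\<^sup>2"
    using \<kappa> by (intro order_tendstoD) auto
  have ev_a: "\<forall>\<^sub>F k in sequentially. 199 / 200 < a (N k)"
    using assms(7) by (rule order_tendstoD) auto
  have ev_N: "\<forall>\<^sub>F k in sequentially. 10000001 \<le> N k"
    using assms(1) by (simp add: filterlim_at_top)
  have "(\<lambda>n. (1 / 300 :: real) ^ n + real n * (1 / 150) ^ n * c) \<longlonglongrightarrow> 0" for c :: real
  proof -
    have "(\<lambda>n. (1 / 300 :: real) ^ n) \<longlonglongrightarrow> 0" by real_asymp
    moreover have "(\<lambda>n. real n * (1 / 150) ^ n) \<longlonglongrightarrow> 0" by real_asymp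
    ultimately have "(\<lambda>n. (1 / 300 :: real) ^ n + real n * (1 / 150) ^ n * c) \<longlonglongrightarrow> 0 + 0 * c"
      by (rule tendsto_add[OF _ tendsto_mult_right])
    then show ?thesis by simp
  qed
  then have "(\<lambda>n. 60000 * ((1 / 300) ^ n + real n * (1 / 150) ^ n * (1 / (2 * \<kappa> * \<kappa>\<^sup>2)))) \<longlonglongrightarrow> 60000 * 0"
    by (rule tendsto_mult_left)
  then have "\<forall>\<^sub>F n in sequentially. 60000 * ((1 / 300) ^ n + real n * (1 / 150) ^ n * (1 / (2 * \<kappa> * \<kappa>\<^sup>2))) < 1"
    by (intro order_tendstoD) auto
  then have ev_d: "\<forall>\<^sub>F k in sequentially.
      60000 * ((1 / 300) ^ N k + real (N k) * (1 / 150) ^ N k * (1 / (2 * \<kappa> * \<kappa>\<^sup>2))) < 1"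
    using assms(1) by (rule eventually_compose_filterlim)
  obtain k where k: "C * ((1 - a (N k)) + ln (4 * (real (N k) - 1)) / (real (N k) - 1)) < \<kappa>\<^sup>2"
      "199 / 200 < a (N k)" "10000001 \<le> N k"
      "60000 * ((1 / 300) ^ N k + real (N k) * (1 / 150) ^ N k * (1 / (2 * \<kappa> * \<kappa>\<^sup>2))) < 1"
    using eventually_happens[OF eventually_conj[OF ev_h eventually_conj[OF ev_a eventually_conj[OF ev_N ev_d]]]]
    by auto
  define n where "n = N k"
  have nN: "n \<in> range N" by (simp add: n_def)
  have a1: "a n \<le> 1" using assms(5)[OF nN] by simp
  have n2: "n \<ge> 2" using k(3) by (simp add: n_def)
  have a_low: "199 / 200 \<le> a n" using k(2) by (simp add: n_def)
  have in_disk: "norm z \<le> 1" if "poly (f n) z = 0" for z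
    using assms(4)[OF nN that] .
  have far_n: "\<not> (\<exists>z. norm (z - complex_of_real (a n)) \<le> 1 \<and> poly (pderiv (f n)) z = 0)"
    using no_crit nN by blast
  obtain r \<zeta> where "far_critical_points n (f n) (a n) r \<zeta>"
    using far_critical_pointsI[OF n2 assms(2)[OF nN] assms(3)[OF nN] in_disk a_low a1 assms(6)[OF nN] far_n]
    by blast
  then interpret far_critical_points n "f n" "a n" r \<zeta> .
  have "mean_crit\<^sup>2 \<le> C * ((1 - a n) + ln (4 * (real n - 1)) / (real n - 1))"
    unfolding C_def by (rule mean_square_small) (use k z z_near z1 in \<open>auto simp: n_def\<close>)
  also have "\<dots> \<le> \<kappa>\<^sup>2" using k(1) by (simp add: n_def)
  finally have h: "mean_crit \<le> \<kappa>" by (rule power2_le_imp_le) (use \<kappa> in simp)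
  have "1 - a n \<le> 60000 * (mean_crit ^ n + n * (\<kappa> + mean_crit) ^ (n - 1) / \<kappa> ^ 2)"
    using h \<kappa> k(3) by (intro gap_le) (auto simp: n_def)
  also have "\<dots> \<le> 60000 * (\<kappa> ^ n + n * (2 * \<kappa>) ^ (n - 1) / \<kappa> ^ 2)"
    using h \<kappa> mean_crit_ge_0 by (intro mult_left_mono add_mono divide_right_mono power_mono) auto
  also have "\<dots> = \<epsilon> ^ n * (60000 * ((1 / 300) ^ n + n * (1 / 150) ^ n * (1 / (2 * \<kappa> * \<kappa>\<^sup>2))))"
  proof -
    have "(2 * \<kappa>) ^ (n - 1) = (2 * \<kappa>) ^ n / (2 * \<kappa>)"
      using \<kappa> n2 by (subst power_diff) auto
    also have "2 * \<kappa> = \<epsilon> * (1 / 150)" by (simp add: \<kappa>_def)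
    then have "(2 * \<kappa>) ^ n = \<epsilon> ^ n * (1 / 150) ^ n" by (simp only: power_mult_distrib)
    finally have 1: "(2 * \<kappa>) ^ (n - 1) = \<epsilon> ^ n * (1 / 150) ^ n / (2 * \<kappa>)" .
    have "\<kappa> = \<epsilon> * (1 / 300)" by (simp add: \<kappa>_def)
    then have 2: "\<kappa> ^ n = \<epsilon> ^ n * (1 / 300) ^ n" by (simp only: power_mult_distrib)
    have "60000 * (E * A + m * (E * B / (2 * x)) / x\<^sup>2) = E * (60000 * (A + m * B * (1 / (2 * x * x\<^sup>2))))"
      for E A B m x :: real
      by (simp add: algebra_simps)
    then show ?thesis unfolding 1 2 .
  qed
  also have "\<dots> < \<epsilon> ^ n * 1"
    using k(4) \<epsilon> by (intro mult_strict_left_mono) (auto simp: n_def)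
  also have "\<epsilon> ^ n * 1 \<le> \<epsilon>\<^sub>0 ^ n" using \<epsilon> by (simp add: power_mono)
  finally show False using assms(9)[OF nN] by simp
qed

end
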